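(* Let $G$ be a finite group and $p$ a prime dividing $|G|$. Let $c$ be the number of conjugacy classes of the group $\langle G_p\rangle$ consisting of $p$-power order elements (i.e. contained in $G_p$). Then $$\Delta(\overline{\mathcal{R}(G_p)})\simeq S^{c-2}*\Delta(\mathcal{P}(G_p)).$$
   Context: $G_p$ is the set of elements of $G$ whose order is a power of $p$, viewed as a rack under $a\triangleright b=aba^{-1}$. $\mathcal{R}(G_p)$ is its lattice of subracks (subsets closed under $\triangleright$, including $\emptyset$), $\overline{\mathcal{R}(G_p)}=\mathcal{R}(G_p)\setminus\{G_p,\emptyset\}$, and $\mathsf{Inf}(\mathcal{R}(G_p))$ is the subposet of $\overline{\mathcal{R}(G_p)}$ of intersections of sets of maximal proper subracks. $\mathsf{Inn}(G_p)$ is the group generated by the conjugation maps by elements of $G_p$. Spherical subracks: $\mathcal{S}(X)=\{S\in\mathsf{Inf}(\mathcal{R}(X)): S$ is a union of $\mathsf{Inn}(X)$-orbits$\}$; parabolic subracks: $\mathcal{P}(X)=\{P\in\mathsf{Inf}(\mathcal{R}(X)): P\cap S\neq\emptyset$ for all $S\in\mathcal{S}(X)\}$, ordered by inclusion. $\Delta$ is the order complex, $*$ the join, $S^k$ the $k$-sphere ($S^{-1}=\emptyset$), and $\simeq$ homotopy equivalence. *)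

theory Defs
  imports "HOL-Analysis.Analysis" "HOL-Algebra.Bij" "HOL-Algebra.Generated_Groups" "HOL-Algebra.Multiplicative_Group"
begin

text \<open>Geometric realisation of the order complex of a finite poset (P, le):
  barycentric-coordinate functions f : 'x => real, supported in P, nonnegative,
  summing to 1 over P, whose support is a chain.  Subspace of the product topology.
  For P empty the realisation is empty.\<close>
definition order_complex :: "'x set \<Rightarrow> ('x \<Rightarrow> 'x \<Rightarrow> bool) \<Rightarrow> ('x \<Rightarrow> real) topology" where
  "order_complex P rel = subtopology (powertop_real UNIV)
     {f. (\<forall>x. f x \<ge> 0) \<and> (\<forall>x. x \<notin> P \<longrightarrow> f x = 0) \<and> (\<Sum>x\<in>P. f x) = 1 \<and>
         (\<forall>x y. f x \<noteq> 0 \<longrightarrow> f y \<noteq> 0 \<longrightarrow> rel x y \<or> rel y x)}"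

definition sphere_space :: "int \<Rightarrow> (nat \<Rightarrow> real) topology" where
  "sphere_space k = (if k < 0 then discrete_topology {} else nsphere (nat k))"

text \<open>Join of topological spaces X * Y: the pushout/quotient of
  X \<squnion> Y \<squnion> (X \<times> Y \<times> [0,1]) identifying (x,y,0) with x and (x,y,1) with y.
  Points are represented by canonical representatives; so X * (empty) = X.\<close>
datatype ('a, 'b) joinpt = JL 'a | JR 'b | JM 'a 'b real

definition join_quot :: "'a \<Rightarrow> 'b \<Rightarrow> real \<Rightarrow> ('a, 'b) joinpt" where
  "join_quot x y t = (if t = 0 then JL x else if t = 1 then JR y else JM x y t)"

definition join_carrier :: "'a topology \<Rightarrow> 'b topology \<Rightarrow> ('a, 'b) joinpt set" where
  "join_carrier X Y = JL ` topspace X \<union> JR ` topspace Y \<union>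
     {JM x y t | x y t. x \<in> topspace X \<and> y \<in> topspace Y \<and> 0 < t \<and> t < 1}"

definition join_space :: "'a topology \<Rightarrow> 'b topology \<Rightarrow> ('a, 'b) joinpt topology" where
  "join_space X Y = topology (\<lambda>U. U \<subseteq> join_carrier X Y \<and>
     openin X {x \<in> topspace X. JL x \<in> U} \<and>
     openin Y {y \<in> topspace Y. JR y \<in> U} \<and>
     openin (prod_topology X (prod_topology Y (top_of_set {0..1::real})))
        {(x, y, t). x \<in> topspace X \<and> y \<in> topspace Y \<and> t \<in> {0..1} \<and> join_quot x y t \<in> U})"

context group
begin

definition p_elements :: "nat \<Rightarrow> 'a set" where
  "p_elements p = {g \<in> carrier G. \<exists>k::nat. ord g = p ^ k}"

definition subracks :: "'a set \<Rightarrow> 'a set set" where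
  "subracks X = {S. S \<subseteq> X \<and> (\<forall>a\<in>S. \<forall>b\<in>S. a \<otimes> b \<otimes> inv a \<in> S)}"

definition proper_subracks :: "'a set \<Rightarrow> 'a set set" where
  "proper_subracks X = subracks X - {X, {}}"

definition maximal_subracks :: "'a set \<Rightarrow> 'a set set" where
  "maximal_subracks X = {S \<in> subracks X - {X}. \<forall>T \<in> subracks X - {X}. S \<subseteq> T \<longrightarrow> T = S}"

definition inf_subracks :: "'a set \<Rightarrow> 'a set set" where
  "inf_subracks X = {S \<in> proper_subracks X. \<exists>M. M \<subseteq> maximal_subracks X \<and> M \<noteq> {} \<and> S = \<Inter>M}"

definition Inn :: "'a set \<Rightarrow> ('a \<Rightarrow> 'a) set" where
  "Inn X = generate (BijGroup X) {(\<lambda>b \<in> X. a \<otimes> b \<otimes> inv a) | a. a \<in> X}"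

definition spherical_subracks :: "'a set \<Rightarrow> 'a set set" where
  "spherical_subracks X = {S \<in> inf_subracks X. \<forall>\<phi> \<in> Inn X. \<forall>s \<in> S. \<phi> s \<in> S}"

definition parabolic_subracks :: "'a set \<Rightarrow> 'a set set" where
  "parabolic_subracks X = {P \<in> inf_subracks X. \<forall>S \<in> spherical_subracks X. P \<inter> S \<noteq> {}}"

definition conj_classes_in :: "'a set \<Rightarrow> 'a set \<Rightarrow> 'a set set" where
  "conj_classes_in H X = {C. \<exists>x \<in> H. C = {h \<otimes> x \<otimes> inv h | h. h \<in> H} \<and> C \<subseteq> X}"

end

end

(* A subrack A either misses a conjugacy class, in which case it generates the spherical subrack
   "union of the classes that A meets", or it meets all of them, in which case the intersection
   of the maximal subracks above A is parabolic.  The spherical subracks are all nonempty proper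
   unions of classes, so their order complex is the boundary of a simplex on c vertices.  This
   retraction f of the proper subracks is monotone onto the ordinal sum (spherical below
   parabolic), whose order complex is the join.

   For a homotopy inverse of the map induced by f, view a point of a realisation as a monotone step
   function on [0,1).  A point of the join consists of a step function J into the spherical
   subracks on [0,a) followed by a step function P into the parabolic ones on [a,1).  Continue J
   by the whole rack, shift P to 0 and continue it by the whole rack too, and intersect the two
   pointwise, cutting off where both are the whole rack.  Applied to the image of u this gives a
   step function that dominates u pointwise, and exchanging u for it from the right end is a
   homotopy. *)
theory Submission
  imports Defs "HOL-Algebra.Sylow"
begin

subsection \<open>Points of a realisation as step functions\<close>

text \<open>The ordinal sum is not a subposet of the proper subracks: a spherical \<open>J\<close>
  need not lie in a parabolic \<open>P\<close>. What every such pair does have is the meet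
  \<open>J \<inter> P\<close>, a proper nonempty subrack that \<open>f\<close> sends back to
  \<open>J\<close>. A chain of spherical and a chain of parabolic subracks give a chain of meets
  along a monotone lattice path, and the masses select this path continuously.

  Shifting the parabolic part to 0 keeps the domination of \<open>u\<close>, because it replaces a
  value of \<open>u\<close> by a later, larger one. If \<open>a\<close> is the mass of the spherical
  part, both step functions have reached the whole rack exactly on [max(a, 1-a), 1), so at least
  half of the mass survives the cut and can be rescaled to 1.

  The identity and an element of order \<open>p\<close> lie in different classes, so c is at least 2
  and the sphere is nonempty. Sphere and join are matched with realisations by continuous bijections
  from compact to Hausdorff spaces.\<close>

definition chain_points :: "'x set \<Rightarrow> ('x \<Rightarrow> 'x \<Rightarrow> bool) \<Rightarrow> ('x \<Rightarrow> real) set" where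
  "chain_points P rel = {f. (\<forall>x. f x \<ge> 0) \<and> (\<forall>x. x \<notin> P \<longrightarrow> f x = 0) \<and> (\<Sum>x\<in>P. f x) = 1 \<and>
         (\<forall>x y. f x \<noteq> 0 \<longrightarrow> f y \<noteq> 0 \<longrightarrow> rel x y \<or> rel y x)}"

text \<open>Function types carry the product topology as their class topology, so the
  \<open>continuous_on\<close> calculus becomes available.\<close>

lemma order_complex_eq: "order_complex P rel = top_of_set (chain_points P rel)"
  unfolding order_complex_def chain_points_def euclidean_product_topology ..

lemma chain_pointsI:
  assumes "\<And>x. f x \<ge> 0" "\<And>x. f x \<noteq> 0 \<Longrightarrow> x \<in> P" "(\<Sum>x\<in>P. f x) = 1"
    "\<And>x y. f x \<noteq> 0 \<Longrightarrow> f y \<noteq> 0 \<Longrightarrow> rel x y \<or> rel y x"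
  shows "f \<in> chain_points P rel"
  using assms unfolding chain_points_def by blast

lemma chain_pointsD:
  assumes "f \<in> chain_points P rel"
  shows "f x \<ge> 0" "f x \<noteq> 0 \<Longrightarrow> x \<in> P" "(\<Sum>x\<in>P. f x) = 1"
    "f x \<noteq> 0 \<Longrightarrow> f y \<noteq> 0 \<Longrightarrow> rel x y \<or> rel y x"
  using assms unfolding chain_points_def by blast+

text \<open>The left end of the interval on which the step function takes the value
  \<open>x\<close>: a cumulative distribution function without the jump at \<open>x\<close>.\<close>

definition mass_below :: "'x::order set \<Rightarrow> ('x \<Rightarrow> real) \<Rightarrow> 'x \<Rightarrow> real" where
  "mass_below Y u x = (\<Sum>y | y \<in> Y \<and> y < x. u y)"

text \<open>A point \<open>u\<close> of the realisation is the same as a monotone step function from \<open>[0, 1)\<close> to the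
  poset, with value \<open>x\<close> on an interval of length \<open>u x\<close>; \<open>quantile Y u s x\<close> says that its value
  at \<open>s\<close> is \<open>x\<close>.\<close>

definition quantile :: "'x::order set \<Rightarrow> ('x \<Rightarrow> real) \<Rightarrow> real \<Rightarrow> 'x \<Rightarrow> bool" where
  "quantile Y u s x \<longleftrightarrow> x \<in> Y \<and> mass_below Y u x \<le> s \<and> s < mass_below Y u x + u x"

lemma mass_below_nonneg: "u \<in> chain_points Y rel \<Longrightarrow> 0 \<le> mass_below Y u x"
  unfolding mass_below_def by (intro sum_nonneg) (auto dest: chain_pointsD(1))

lemma mass_below_insert:
  "finite Y \<Longrightarrow> x \<in> Y \<Longrightarrow> mass_below Y u x + u x = (\<Sum>y\<in>insert x {y \<in> Y. y < x}. u y)"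
  unfolding mass_below_def by (subst sum.insert) auto

lemma mass_up_to_le:
  assumes "u \<in> chain_points Y rel" "finite Y" "x \<in> Y" "insert x {y \<in> Y. y < x} \<subseteq> B" "finite B"
  shows "mass_below Y u x + u x \<le> sum u B"
  unfolding mass_below_insert[OF assms(2,3)]
  using assms by (intro sum_mono2) (auto dest: chain_pointsD(1))

lemma mass_up_to_le_1:
  assumes "u \<in> chain_points Y rel" "finite Y" "x \<in> Y"
  shows "mass_below Y u x + u x \<le> 1"
  using mass_up_to_le[OF assms, of Y] chain_pointsD(3)[OF assms(1)] assms(2,3) by auto

lemma quantileD:
  assumes "u \<in> chain_points Y rel" "finite Y" "quantile Y u s x"
  shows "x \<in> Y" "0 \<le> s" "s < 1" "u x > 0"
  using assms mass_below_nonneg[OF assms(1), of x] mass_up_to_le_1[OF assms(1,2), of x]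
  unfolding quantile_def by auto

text \<open>If \<open>y\<close> were strictly below \<open>x\<close>, the half-open interval of
  \<open>y\<close> would end no later than that of \<open>x\<close> begins.\<close>

lemma quantile_mono:
  assumes u: "u \<in> chain_points Y (\<le>)" and "finite Y"
    and x: "quantile Y u s x" and y: "quantile Y u t y" and "s \<le> t"
  shows "x \<le> y"
proof (rule ccontr)
  assume "\<not> x \<le> y"
  moreover have "u x \<noteq> 0" "u y \<noteq> 0" "x \<in> Y" "y \<in> Y"
    using quantileD[OF u \<open>finite Y\<close>] x y by force+
  ultimately have "y < x" using chain_pointsD(4)[OF u, of x y] by auto
  then have "mass_below Y u y + u y \<le> mass_below Y u x"
    unfolding mass_below_def[of _ _ x]
    using \<open>finite Y\<close> \<open>y \<in> Y\<close> by (intro mass_up_to_le[OF u]) auto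
  then show False using x y \<open>s \<le> t\<close> unfolding quantile_def by linarith
qed

lemma quantile_unique:
  assumes "u \<in> chain_points Y (\<le>)" and "finite Y"
    and "quantile Y u s x" and "quantile Y u s y"
  shows "x = y"
  using quantile_mono[OF assms] quantile_mono[OF assms(1,2,4,3)] by auto

lemma quantile_ex:
  assumes u: "u \<in> chain_points Y (\<le>)" and "finite Y" and s: "0 \<le> s" "s < 1"
  shows "\<exists>x. quantile Y u s x"
proof -
  define S where "S = {x \<in> Y. u x \<noteq> 0}"
  define T where "T = {x \<in> S. mass_below Y u x + u x \<le> s}"
  have fin: "finite S" "finite T" using \<open>finite Y\<close> by (auto simp: S_def T_def)
  have chain: "x \<le> y \<or> y \<le> x" if "x \<in> S" "y \<in> S" for x y
    using that chain_pointsD(4)[OF u] by (auto simp: S_def)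
  \<comment> \<open>\<open>T\<close> is a chain, so all its mass is counted in the mass up to its
    greatest element, whose interval ends by \<open>s\<close>.\<close>
  have T_le: "sum u T \<le> s"
  proof (cases "T = {}")
    case False
    obtain m where m: "m \<in> T" "\<And>x. x \<in> T \<Longrightarrow> m \<le> x \<Longrightarrow> m = x"
      using finite_has_maximal[OF fin(2) False] by metis
    have "x \<le> m" if "x \<in> T" for x using chain[of x m] m that by (auto simp: T_def)
    then have "T \<subseteq> insert m {y \<in> Y. y < m}" by (force simp: T_def S_def)
    then have "sum u T \<le> mass_below Y u m + u m"
      using m \<open>finite Y\<close> mass_below_insert[of Y m u]
      by (auto simp: T_def S_def simp del: sum.insert intro!: sum_mono2 chain_pointsD(1)[OF u])
    then show ?thesis using m by (auto simp: T_def)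
  qed (use s in auto)
  have "sum u S = 1"
    unfolding chain_pointsD(3)[OF u, symmetric] S_def using \<open>finite Y\<close>
    by (intro sum.mono_neutral_left) auto
  then have "S \<noteq> T" using T_le s by auto
  then have "S - T \<noteq> {}" unfolding T_def by auto
  \<comment> \<open>The interval of \<open>m\<close> ends after \<open>s\<close> because
    \<open>m\<close> is not in \<open>T\<close>. It starts by \<open>s\<close> because, by
    minimality, the support below \<open>m\<close> lies in \<open>T\<close>.\<close>
  then obtain m where m: "m \<in> S - T" "\<And>x. x \<in> S - T \<Longrightarrow> x \<le> m \<Longrightarrow> m = x"
    using finite_has_minimal[of "S - T"] fin by (metis finite_Diff)
  have "mass_below Y u m = (\<Sum>y | y \<in> S \<and> y < m. u y)"
    unfolding mass_below_def using \<open>finite Y\<close> by (intro sum.mono_neutral_right) (auto simp: S_def)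
  also have "\<dots> \<le> sum u T"
    using m fin by (intro sum_mono2 chain_pointsD(1)[OF u]) force+
  finally have "quantile Y u s m" using m T_le unfolding quantile_def by (auto simp: T_def S_def)
  then show ?thesis by blast
qed

section \<open>Push-forward along a map: the simplicial map that it induces on realisations\<close>

definition push :: "('x \<Rightarrow> 'y) \<Rightarrow> 'x set \<Rightarrow> ('x \<Rightarrow> real) \<Rightarrow> 'y \<Rightarrow> real" where
  "push \<phi> Y u z = (\<Sum>y | y \<in> Y \<and> \<phi> y = z. u y)"

lemma push_nonzeroD: "push \<phi> Y u z \<noteq> 0 \<Longrightarrow> \<exists>y\<in>Y. \<phi> y = z \<and> u y \<noteq> 0"
  unfolding push_def by (metis (mono_tags, lifting) mem_Collect_eq sum.neutral)

lemma sum_push: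
  assumes "finite Y" "finite Z"
  shows "(\<Sum>z\<in>Z. push \<phi> Y u z) = (\<Sum>y | y \<in> Y \<and> \<phi> y \<in> Z. u y)"
proof -
  have "(\<Sum>z\<in>Z. push \<phi> Y u z) = (\<Sum>z\<in>Z. \<Sum>y | y \<in> {y \<in> Y. \<phi> y \<in> Z} \<and> \<phi> y = z. u y)"
    unfolding push_def by (intro sum.cong refl) auto
  also have "\<dots> = (\<Sum>y | y \<in> Y \<and> \<phi> y \<in> Z. u y)"
    using assms by (intro sum.group) auto
  finally show ?thesis .
qed

lemma push_chain_points:
  assumes u: "u \<in> chain_points Y rel" and "finite Y" "finite Z" "\<And>y. y \<in> Y \<Longrightarrow> \<phi> y \<in> Z"
    and "\<And>x y. x \<in> Y \<Longrightarrow> y \<in> Y \<Longrightarrow> rel x y \<Longrightarrow> rel' (\<phi> x) (\<phi> y)"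
  shows "push \<phi> Y u \<in> chain_points Z rel'"
proof (rule chain_pointsI)
  show "push \<phi> Y u x \<ge> 0" for x
    unfolding push_def by (intro sum_nonneg chain_pointsD(1)[OF u])
  show "push \<phi> Y u x \<noteq> 0 \<Longrightarrow> x \<in> Z" for x
    using push_nonzeroD assms(4) by metis
  have "{y \<in> Y. \<phi> y \<in> Z} = Y" using assms(4) by auto
  then show "sum (push \<phi> Y u) Z = 1"
    unfolding sum_push[OF assms(2,3)] using chain_pointsD(3)[OF u] by metis
  fix x y assume "push \<phi> Y u x \<noteq> 0" "push \<phi> Y u y \<noteq> 0"
  from this[THEN push_nonzeroD] show "rel' x y \<or> rel' y x"
    using chain_pointsD(4)[OF u] assms(5) by metis
qed

text \<open>Merging the intervals of values with equal image leaves every position \<open>s\<close>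
  in place, so \<open>push\<close> amounts to composing the step function with
  \<open>\<phi>\<close>.\<close>

lemma quantile_push:
  assumes u: "u \<in> chain_points Y (\<le>)" and fin: "finite Y" "finite Z"
    and map: "\<And>y. y \<in> Y \<Longrightarrow> \<phi> y \<in> Z"
    and mono: "\<And>x y. x \<in> Y \<Longrightarrow> y \<in> Y \<Longrightarrow> x \<le> y \<Longrightarrow> \<phi> x \<le> \<phi> y"
    and x: "quantile Y u s x"
  shows "quantile Z (push \<phi> Y u) s (\<phi> x)"
proof -
  have xY: "x \<in> Y" and ux: "u x \<noteq> 0" using quantileD[OF u fin(1) x] by auto
  have nonneg: "\<And>y. 0 \<le> u y" using chain_pointsD(1)[OF u] .
  have below: "mass_below Z (push \<phi> Y u) (\<phi> x) = (\<Sum>y | y \<in> Y \<and> \<phi> y < \<phi> x. u y)"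
    unfolding mass_below_def using fin map by (subst sum_push) (auto intro!: sum.cong)
  also have "\<dots> = (\<Sum>y | y \<in> Y \<and> \<phi> y < \<phi> x \<and> u y \<noteq> 0. u y)"
    using fin by (intro sum.mono_neutral_right) auto
  also have "\<dots> \<le> mass_below Y u x"
    unfolding mass_below_def
  proof (intro sum_mono2 nonneg)
    \<comment> \<open>Elements of the support are comparable with \<open>x\<close>, and
      \<open>x \<le> y\<close> would give \<open>\<phi> x \<le> \<phi> y\<close>.\<close>
    show "{y \<in> Y. \<phi> y < \<phi> x \<and> u y \<noteq> 0} \<subseteq> {y \<in> Y. y < x}"
      using chain_pointsD(4)[OF u, of _ x] ux mono[OF xY]
      by (smt (verit) Collect_mono leD order_le_imp_less_or_eq)
  qed (use fin in auto)
  finally have 1: "mass_below Z (push \<phi> Y u) (\<phi> x) \<le> s" using x by (auto simp: quantile_def)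
  have "s < (\<Sum>y\<in>insert x {y \<in> Y. y < x}. u y)"
    using x mass_below_insert[OF fin(1) xY] by (auto simp: quantile_def)
  also have "\<dots> \<le> (\<Sum>y\<in>{y \<in> Y. \<phi> y < \<phi> x} \<union> {y \<in> Y. \<phi> y = \<phi> x}. u y)"
    using fin xY mono[OF _ xY] by (intro sum_mono2 nonneg) (auto simp: order.order_iff_strict)
  also have "\<dots> = (\<Sum>y\<in>{y \<in> Y. \<phi> y < \<phi> x}. u y) + push \<phi> Y u (\<phi> x)"
    unfolding push_def using fin by (intro sum.union_disjoint) auto
  finally show ?thesis using 1 below map[OF xY] by (simp add: quantile_def)
qed

subsection \<open>Two-tiered families of sets\<close>

definition normalise :: "'x set \<Rightarrow> ('x \<Rightarrow> real) \<Rightarrow> 'x \<Rightarrow> real" where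
  "normalise P w x = w x / sum w P"

lemma normalise_chain_points:
  assumes "\<And>x. w x \<ge> 0" "\<And>x. w x \<noteq> 0 \<Longrightarrow> x \<in> P" "sum w P > 0"
    and "\<And>x y. w x \<noteq> 0 \<Longrightarrow> w y \<noteq> 0 \<Longrightarrow> rel x y \<or> rel y x"
  shows "normalise P w \<in> chain_points P rel"
  using assms
  by (intro chain_pointsI) (auto simp: normalise_def sum_divide_distrib[symmetric])

lemma normalise_id: "w \<in> chain_points P rel \<Longrightarrow> normalise P w = w"
  by (auto simp: normalise_def fun_eq_iff dest: chain_pointsD(3))

lemma continuous_on_eval: "continuous_on S (\<lambda>w::'x \<Rightarrow> 'y::topological_space. w x)"
  by (rule continuous_on_product_then_coordinatewise[OF continuous_on_id])

lemma continuous_on_snd_eval: "continuous_on S (\<lambda>q::'z::topological_space \<times> ('x \<Rightarrow> 'y::topological_space). snd q x)"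
  by (rule continuous_on_product_then_coordinatewise[OF continuous_on_snd[OF continuous_on_id]])

lemma continuous_on_normalise:
  assumes "\<And>x. continuous_on S (\<lambda>s. w s x)" "\<And>s. s \<in> S \<Longrightarrow> sum (w s) P \<noteq> 0"
  shows "continuous_on S (\<lambda>s. normalise P (w s))"
  unfolding normalise_def
  by (intro continuous_on_coordinatewise_then_product continuous_on_divide continuous_on_sum assms)
    (use assms(2) in blast)

text \<open>The whole segment stays in the closed simplex spanned by the support of
  \<open>w\<close>.\<close>

lemma chain_points_convex_subsupport:
  assumes w: "w \<in> chain_points P rel" and v: "v \<in> chain_points P rel"
    and supp: "\<And>x. v x \<noteq> 0 \<Longrightarrow> w x \<noteq> 0" and t: "0 \<le> t" "t \<le> (1::real)"
  shows "(\<lambda>x. (1 - t) * v x + t * w x) \<in> chain_points P rel"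
proof (rule chain_pointsI)
  show "(1 - t) * v x + t * w x \<ge> 0" for x
    using chain_pointsD(1)[OF w] chain_pointsD(1)[OF v] t by simp
  have nz: "w x \<noteq> 0" if "(1 - t) * v x + t * w x \<noteq> 0" for x
    using that supp[of x] by auto
  then show "(1 - t) * v x + t * w x \<noteq> 0 \<Longrightarrow> x \<in> P" for x
    using chain_pointsD(2)[OF w] by blast
  show "(\<Sum>x\<in>P. (1 - t) * v x + t * w x) = 1"
    using chain_pointsD(3)[OF w] chain_pointsD(3)[OF v]
    by (simp add: sum.distrib sum_distrib_left[symmetric])
  show "rel x y \<or> rel y x"
    if "(1 - t) * v x + t * w x \<noteq> 0" "(1 - t) * v y + t * w y \<noteq> 0" for x y
    using nz[OF that(1)] nz[OF that(2)] chain_pointsD(4)[OF w] by blast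
qed

lemma homotopic_withI_top_of_set:
  assumes "continuous_on ({0..1::real} \<times> S) h" "\<And>t x. t \<in> {0..1} \<Longrightarrow> x \<in> S \<Longrightarrow> h (t, x) \<in> T"
    and "\<And>x. x \<in> S \<Longrightarrow> h (0, x) = f x" "\<And>x. x \<in> S \<Longrightarrow> h (1, x) = g x"
  shows "homotopic_with_canon (\<lambda>_. True) S T f g"
proof -
  have "homotopic_with_canon (\<lambda>_. True) S T (\<lambda>x. h (0, x)) (\<lambda>x. h (1, x))"
    unfolding homotopic_with_def prod_topology_subtopology_eu continuous_map_subtopology_eu
    using assms(1,2) by (intro exI[of _ h]) auto
  then show ?thesis
    by (rule homotopic_with_eq) (use assms(3,4) in auto)
qed

lemma continuous_on_mass_below:
  assumes "\<And>x. continuous_on S (\<lambda>s. u s x)"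
  shows "continuous_on S (\<lambda>s. mass_below Y (u s) x)"
  unfolding mass_below_def by (intro continuous_on_sum assms)

text \<open>The order of the ordinal sum of \<open>S\<close> and its complement. It needs a relation
  of its own because elements of different tiers may be incomparable under
  \<open>\<le>\<close>.\<close>

definition tier :: "'x::order set \<Rightarrow> 'x \<Rightarrow> 'x \<Rightarrow> bool" where
  "tier S x y \<longleftrightarrow> x \<in> S \<and> y \<notin> S \<or> (x \<in> S \<longleftrightarrow> y \<in> S) \<and> x \<le> y"

text \<open>All that the homotopy equivalence needs to know about racks. \<open>f_SS\<close> and
  \<open>f_mono\<close> together say that \<open>f\<close> is monotone into the ordinal sum.
  \<open>meet_in\<close> and \<open>f_meet\<close> make up for the missing inclusions between the
  tiers.\<close>

locale two_tier =
  fixes R SS PP :: "'a set set" and X :: "'a set" and f :: "'a set \<Rightarrow> 'a set"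
  assumes finite_R: "finite R"
    and SS_R: "SS \<subseteq> R" and PP_R: "PP \<subseteq> R" and disj: "SS \<inter> PP = {}"
    and R_X: "A \<in> R \<Longrightarrow> A \<subseteq> X" and X_notin_R: "X \<notin> R" and empty_notin_R: "{} \<notin> R"
    and f_in: "A \<in> R \<Longrightarrow> f A \<in> SS \<union> PP"
    and f_ge: "A \<in> R \<Longrightarrow> A \<subseteq> f A"
    and f_SS: "A \<in> R \<Longrightarrow> B \<in> R \<Longrightarrow> A \<subseteq> B \<Longrightarrow> f B \<in> SS \<Longrightarrow> f A \<in> SS"
    and f_mono: "A \<in> R \<Longrightarrow> B \<in> R \<Longrightarrow> A \<subseteq> B \<Longrightarrow> (f A \<in> SS \<longleftrightarrow> f B \<in> SS) \<Longrightarrow> f A \<subseteq> f B"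
    and f_id: "A \<in> SS \<union> PP \<Longrightarrow> f A = A"
    and meet_in: "J \<in> SS \<Longrightarrow> P \<in> PP \<Longrightarrow> J \<inter> P \<in> R"
    and f_meet: "J \<in> SS \<Longrightarrow> P \<in> PP \<Longrightarrow> f (J \<inter> P) = J"
begin

lemma finite_SS: "finite SS" and finite_PP: "finite PP"
  using finite_R SS_R PP_R finite_subset by auto

lemma X_notin: "X \<notin> SS" "X \<notin> PP"
  using X_notin_R SS_R PP_R by auto

text \<open>The step function of \<open>S_part w\<close> is that of \<open>w\<close> with the values in \<open>PP\<close> replaced by the top
  element \<open>X\<close>; the step function of \<open>P_part w\<close> is that of \<open>w\<close> shifted to the left by the mass of
  \<open>SS\<close> and continued by \<open>X\<close>.\<close>

definition S_part :: "('a set \<Rightarrow> real) \<Rightarrow> 'a set \<Rightarrow> real" where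
  "S_part w A = (if A = X then sum w PP else if A \<in> SS then w A else 0)"

definition P_part :: "('a set \<Rightarrow> real) \<Rightarrow> 'a set \<Rightarrow> real" where
  "P_part w A = (if A = X then sum w SS else if A \<in> PP then w A else 0)"

definition proper_pairs :: "('a set \<times> 'a set) set" where
  "proper_pairs = insert X SS \<times> insert X PP - {(X, X)}"

text \<open>The length of the intersection of the interval of \<open>J\<close>, the interval of
  \<open>P\<close> and the half-line from \<open>r\<close>. Written with \<open>min\<close> and
  \<open>max\<close>, it is visibly continuous in \<open>r\<close> and \<open>w\<close>.\<close>

definition overlap :: "real \<Rightarrow> ('a set \<Rightarrow> real) \<Rightarrow> 'a set \<times> 'a set \<Rightarrow> real" where
  "overlap r w = (\<lambda>(J, P). max 0
    (min (mass_below (insert X SS) (S_part w) J + S_part w J)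
         (mass_below (insert X PP) (P_part w) P + P_part w P)
     - max (max (mass_below (insert X SS) (S_part w) J) (mass_below (insert X PP) (P_part w) P)) r))"

text \<open>The part over \<open>[r, 1)\<close> of the step function that is the intersection of those of \<open>S_part w\<close>
  and \<open>P_part w\<close>, with the final value \<open>X\<close> cut off.\<close>

definition staircase :: "real \<Rightarrow> ('a set \<Rightarrow> real) \<Rightarrow> 'a set \<Rightarrow> real" where
  "staircase r w A = (\<Sum>q | q \<in> proper_pairs \<and> fst q \<inter> snd q = A. overlap r w q)"

lemma finite_proper_pairs: "finite proper_pairs"
  unfolding proper_pairs_def using finite_SS finite_PP by auto

lemma proper_pairs_in: "(J, P) \<in> proper_pairs \<Longrightarrow> J \<inter> P \<in> R"
  using meet_in SS_R PP_R R_X unfolding proper_pairs_def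
  by (auto simp: Int_absorb1 Int_absorb2)

lemma overlap_nonneg: "overlap r w q \<ge> 0"
  unfolding overlap_def by (auto split: prod.split)

lemma overlap_pos_iff:
  assumes "J \<in> insert X SS" "P \<in> insert X PP"
  shows "overlap r w (J, P) > 0 \<longleftrightarrow>
    (\<exists>s\<ge>r. quantile (insert X SS) (S_part w) s J \<and> quantile (insert X PP) (P_part w) s P)"
    (is "?L \<longleftrightarrow> ?R")
proof
  \<comment> \<open>The left end of the intersection, which belongs to it as soon as the length is
    positive.\<close>
  let ?s = "max (max (mass_below (insert X SS) (S_part w) J) (mass_below (insert X PP) (P_part w) P)) r"
  assume ?L
  then show ?R using assms
    unfolding overlap_def quantile_def by (intro exI[of _ ?s]) auto
next
  assume ?R
  then show ?L using assms
    unfolding overlap_def quantile_def by auto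
qed

lemma staircase_nonneg: "staircase r w A \<ge> 0"
  unfolding staircase_def by (intro sum_nonneg overlap_nonneg)

lemma staircase_nonzeroD:
  assumes "staircase r w A \<noteq> 0"
  obtains J P s where "(J, P) \<in> proper_pairs" "A = J \<inter> P" "r \<le> s"
    "quantile (insert X SS) (S_part w) s J" "quantile (insert X PP) (P_part w) s P"
proof -
  obtain q where q: "q \<in> proper_pairs" "fst q \<inter> snd q = A" "overlap r w q \<noteq> 0"
    using assms unfolding staircase_def by (elim sum.not_neutral_contains_not_neutral) auto
  obtain J P where JP: "q = (J, P)" by fastforce
  have "overlap r w (J, P) > 0" using q(3) overlap_nonneg[of r w q] JP by auto
  moreover have "J \<in> insert X SS" "P \<in> insert X PP" using q JP unfolding proper_pairs_def by auto
  ultimately show thesis using overlap_pos_iff[of J P r w] q JP that by auto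
qed

lemma staircase_posI:
  assumes "(J, P) \<in> proper_pairs" "r \<le> s"
    "quantile (insert X SS) (S_part w) s J" "quantile (insert X PP) (P_part w) s P"
  shows "staircase r w (J \<inter> P) > 0"
proof -
  have "overlap r w (J, P) > 0"
    using overlap_pos_iff[of J P r w] assms unfolding proper_pairs_def by auto
  then show ?thesis unfolding staircase_def using assms(1) finite_proper_pairs
    by (intro sum_pos2[of _ "(J, P)"]) (auto simp: overlap_nonneg)
qed

lemma continuous_on_staircase:
  assumes r: "continuous_on S r" and w: "\<And>A. continuous_on S (\<lambda>s. w s A)"
  shows "continuous_on S (\<lambda>s. staircase (r s) (w s) A)"
proof -
  have b: "continuous_on S (\<lambda>s. S_part (w s) A)" for A
    unfolding S_part_def by (cases "A = X"; cases "A \<in> SS") (auto intro!: continuous_on_sum w)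
  have p: "continuous_on S (\<lambda>s. P_part (w s) A)" for A
    unfolding P_part_def by (cases "A = X"; cases "A \<in> PP") (auto intro!: continuous_on_sum w)
  show ?thesis
    unfolding staircase_def overlap_def case_prod_beta
    by (intro continuous_on_sum continuous_on_max continuous_on_min continuous_on_diff
        continuous_on_add continuous_on_const continuous_on_mass_below r b p)
qed

abbreviation points :: "('a set \<Rightarrow> real) set" where
  "points \<equiv> chain_points R (\<subseteq>)"

abbreviation model :: "('a set \<Rightarrow> real) set" where
  "model \<equiv> chain_points (SS \<union> PP) (tier SS)"

lemma sum_split: "w \<in> model \<Longrightarrow> sum w SS + sum w PP = 1"
  using chain_pointsD(3) sum.union_disjoint[OF finite_SS finite_PP disj] by metis

lemma model_SS_chain: "w \<in> model \<Longrightarrow> A \<in> SS \<Longrightarrow> B \<in> SS \<Longrightarrow> w A \<noteq> 0 \<Longrightarrow> w B \<noteq> 0 \<Longrightarrow> A \<subseteq> B \<or> B \<subseteq> A"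
  using chain_pointsD(4)[of w _ _ A B] unfolding tier_def by auto

lemma model_PP_chain: "w \<in> model \<Longrightarrow> A \<in> PP \<Longrightarrow> B \<in> PP \<Longrightarrow> w A \<noteq> 0 \<Longrightarrow> w B \<noteq> 0 \<Longrightarrow> A \<subseteq> B \<or> B \<subseteq> A"
  using chain_pointsD(4)[of w _ _ A B] disj unfolding tier_def by auto

lemma S_part_in:
  assumes "w \<in> model" shows "S_part w \<in> chain_points (insert X SS) (\<subseteq>)"
proof (rule chain_pointsI)
  note nonneg = chain_pointsD(1)[OF assms]
  show "S_part w A \<ge> 0" for A unfolding S_part_def by (auto intro: nonneg sum_nonneg)
  show "S_part w A \<noteq> 0 \<Longrightarrow> A \<in> insert X SS" for A unfolding S_part_def by (auto split: if_splits)
  have "sum (S_part w) SS = sum w SS"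
    using X_notin by (intro sum.cong) (auto simp: S_part_def)
  then show "sum (S_part w) (insert X SS) = 1"
    using finite_SS X_notin sum_split[OF assms] by (simp add: S_part_def)
  show "A \<subseteq> B \<or> B \<subseteq> A" if "S_part w A \<noteq> 0" "S_part w B \<noteq> 0" for A B
    using that model_SS_chain[OF assms, of A B] SS_R R_X unfolding S_part_def
    by (auto split: if_splits)
qed

lemma P_part_in:
  assumes "w \<in> model" shows "P_part w \<in> chain_points (insert X PP) (\<subseteq>)"
proof (rule chain_pointsI)
  note nonneg = chain_pointsD(1)[OF assms]
  show "P_part w A \<ge> 0" for A unfolding P_part_def by (auto intro: nonneg sum_nonneg)
  show "P_part w A \<noteq> 0 \<Longrightarrow> A \<in> insert X PP" for A unfolding P_part_def by (auto split: if_splits)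
  have "sum (P_part w) PP = sum w PP"
    using X_notin by (intro sum.cong) (auto simp: P_part_def)
  then show "sum (P_part w) (insert X PP) = 1"
    using finite_PP X_notin sum_split[OF assms] by (simp add: P_part_def)
  show "A \<subseteq> B \<or> B \<subseteq> A" if "P_part w A \<noteq> 0" "P_part w B \<noteq> 0" for A B
    using that model_PP_chain[OF assms, of A B] PP_R R_X unfolding P_part_def
    by (auto split: if_splits)
qed

text \<open>The interval of \<open>X\<close> starts at the mass of \<open>SS\<close> in one step
  function and at the mass of \<open>PP\<close> in the other. These masses add up to 1, so at
  position 0 the two values cannot both be \<open>X\<close>.\<close>

lemma sum_staircase_pos:
  assumes "w \<in> model" shows "sum (staircase 0 w) R > 0"
proof -
  obtain J where J: "quantile (insert X SS) (S_part w) 0 J"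
    using quantile_ex[OF S_part_in[OF assms], of 0] finite_SS by auto
  obtain P where P: "quantile (insert X PP) (P_part w) 0 P"
    using quantile_ex[OF P_part_in[OF assms], of 0] finite_PP by auto
  have "(J, P) \<noteq> (X, X)"
  proof
    assume "(J, P) = (X, X)"
    moreover have "mass_below (insert X SS) (S_part w) X = sum w SS"
      unfolding mass_below_def using X_notin SS_R R_X
      by (intro sum.cong) (auto simp: S_part_def)
    moreover have "mass_below (insert X PP) (P_part w) X = sum w PP"
      unfolding mass_below_def using X_notin PP_R R_X
      by (intro sum.cong) (auto simp: P_part_def)
    ultimately show False using J P sum_split[OF assms] unfolding quantile_def by auto
  qed
  then have JP: "(J, P) \<in> proper_pairs"
    using J P unfolding proper_pairs_def quantile_def by auto
  show ?thesis
    using staircase_posI[OF JP _ J P] finite_R proper_pairs_in[OF JP]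
    by (intro sum_pos2[of _ "J \<inter> P"]) (auto simp: staircase_nonneg)
qed

lemma staircase_R: "staircase r w A \<noteq> 0 \<Longrightarrow> A \<in> R"
  by (metis staircase_nonzeroD proper_pairs_in)

lemma staircase_mono:
  assumes w: "w \<in> model"
    and "quantile (insert X SS) (S_part w) s J" "quantile (insert X PP) (P_part w) s P"
    and "quantile (insert X SS) (S_part w) t J'" "quantile (insert X PP) (P_part w) t P'"
    and "s \<le> t"
  shows "J \<inter> P \<subseteq> J' \<inter> P'"
  using quantile_mono[OF S_part_in[OF w] _ assms(2,4)] quantile_mono[OF P_part_in[OF w] _ assms(3,5)]
    finite_SS finite_PP \<open>s \<le> t\<close> by auto

lemma staircase_chain:
  assumes "w \<in> model" "staircase r w A \<noteq> 0" "staircase r w B \<noteq> 0"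
  shows "A \<subseteq> B \<or> B \<subseteq> A"
  using assms(2,3) by (elim staircase_nonzeroD) (metis staircase_mono[OF assms(1)] linear)

section \<open>The maps between the two realisations, and the homotopies of their composites\<close>

definition to_model :: "('a set \<Rightarrow> real) \<Rightarrow> 'a set \<Rightarrow> real" where
  "to_model = push f R"

definition from_model :: "('a set \<Rightarrow> real) \<Rightarrow> 'a set \<Rightarrow> real" where
  "from_model w = normalise R (staircase 0 w)"

lemma to_model_in: "u \<in> points \<Longrightarrow> to_model u \<in> model"
  unfolding to_model_def
proof (rule push_chain_points)
  show "tier SS (f A) (f B)" if "A \<in> R" "B \<in> R" "A \<subseteq> B" for A B
    using f_SS[OF that] f_mono[OF that] unfolding tier_def by blast
qed (use finite_R finite_SS finite_PP f_in in auto)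

lemma from_model_in: "w \<in> model \<Longrightarrow> from_model w \<in> points"
  unfolding from_model_def
  by (intro normalise_chain_points staircase_nonneg sum_staircase_pos staircase_chain staircase_R)

lemma continuous_to_model: "continuous_on S to_model"
  unfolding to_model_def push_def
  by (intro continuous_on_coordinatewise_then_product continuous_on_sum continuous_on_eval)

lemma continuous_from_model: "continuous_on model from_model"
  unfolding from_model_def
  by (intro continuous_on_normalise continuous_on_staircase continuous_on_const
      continuous_on_eval) (use sum_staircase_pos in fastforce)

text \<open>A value of the staircase is \<open>J \<inter> P\<close>. Applying \<open>f\<close> gives
  \<open>J\<close> if \<open>J\<close> is in \<open>SS\<close> and \<open>P\<close> if
  \<open>J\<close> is \<open>X\<close>, and either one is in the support of
  \<open>w\<close>.\<close>

lemma to_from_support: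
  assumes w: "w \<in> model" and "to_model (from_model w) B \<noteq> 0"
  shows "w B \<noteq> 0"
proof -
  obtain A where A: "A \<in> R" "f A = B" "staircase 0 w A \<noteq> 0"
    using push_nonzeroD[OF assms(2)[unfolded to_model_def]]
    by (auto simp: from_model_def normalise_def)
  obtain J P s where JP: "(J, P) \<in> proper_pairs" "A = J \<inter> P"
    and q: "quantile (insert X SS) (S_part w) s J" "quantile (insert X PP) (P_part w) s P"
    using A(3) by (rule staircase_nonzeroD)
  have nz: "S_part w J > 0" "P_part w P > 0"
    using quantileD(4)[OF S_part_in[OF w] _ q(1)] quantileD(4)[OF P_part_in[OF w] _ q(2)]
      finite_SS finite_PP by auto
  show ?thesis
  proof (cases "J = X")
    case True
    then have "P \<in> PP" using JP unfolding proper_pairs_def by auto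
    moreover have "A = P" using True JP \<open>P \<in> PP\<close> PP_R R_X by auto
    ultimately show ?thesis using nz(2) A(2) f_id[of P] X_notin unfolding P_part_def by (auto split: if_splits)
  next
    case False
    then have J: "J \<in> SS" using JP unfolding proper_pairs_def by auto
    have "f A = J"
    proof (cases "P = X")
      case True
      then have "A = J" using JP J SS_R R_X by auto
      then show ?thesis using f_id J by auto
    next
      case False
      then show ?thesis using JP J f_meet unfolding proper_pairs_def by auto
    qed
    then show ?thesis using nz(1) A(2) J False unfolding S_part_def by auto
  qed
qed

text \<open>By the comparison of supports, the straight-line homotopy never leaves a
  simplex.\<close>

lemma homotopic_to_from: "homotopic_with_canon (\<lambda>_. True) model model (to_model \<circ> from_model) id"
proof (rule homotopic_withI_top_of_set)
  let ?h = "\<lambda>q A. (1 - fst q) * to_model (from_model (snd q)) A + fst q * snd q A"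
  have "continuous_on ({0..1} \<times> model) (\<lambda>q. to_model (from_model (snd q)))"
    by (intro continuous_on_compose2[OF continuous_to_model[of UNIV]]
        continuous_on_compose2[OF continuous_from_model] continuous_intros) auto
  then have "continuous_on ({0..1} \<times> model) (\<lambda>q. to_model (from_model (snd q)) A)" for A
    by (rule continuous_on_product_then_coordinatewise)
  then show "continuous_on ({0..1} \<times> model) ?h"
    by (intro continuous_on_coordinatewise_then_product continuous_on_add continuous_on_mult
        continuous_on_diff continuous_on_fst continuous_on_const continuous_on_id continuous_on_snd_eval)
  show "?h (t, w) \<in> model" if "t \<in> {0..1}" "w \<in> model" for t w
    using chain_points_convex_subsupport[OF that(2) to_model_in[OF from_model_in[OF that(2)]]
        to_from_support[OF that(2)], of t] that(1) by simp
qed auto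

text \<open>As the push-forward under a single monotone map, the first step function can be read off
  from that of \<open>u\<close> by \<open>quantile_push\<close>.\<close>

lemma S_part_to_model:
  assumes "u \<in> points"
  shows "S_part (to_model u) = push (\<lambda>A. if f A \<in> SS then f A else X) R u"
proof
  fix B
  have "sum (to_model u) PP = (\<Sum>y | y \<in> R \<and> f y \<in> PP. u y)"
    unfolding to_model_def by (rule sum_push[OF finite_R finite_PP])
  moreover have "{y \<in> R. f y \<in> PP} = {y \<in> R. (if f y \<in> SS then f y else X) = X}"
    using f_in disj X_notin by auto
  moreover have "{y \<in> R. f y = B} = {y \<in> R. (if f y \<in> SS then f y else X) = B}"
    if "B \<in> SS" using that X_notin by auto
  moreover have "{y \<in> R. (if f y \<in> SS then f y else X) = B} = {}"
    if "B \<notin> SS" "B \<noteq> X" using that by auto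
  ultimately show "S_part (to_model u) B = push (\<lambda>A. if f A \<in> SS then f A else X) R u B"
    unfolding S_part_def push_def to_model_def
    by (cases "B = X"; cases "B \<in> SS") (simp_all add: X_notin, auto intro!: sum.neutral)
qed

text \<open>\<open>J\<close> is either \<open>f A\<close> or \<open>X\<close>, and both contain
  \<open>A\<close>.\<close>

lemma below_S_part:
  assumes u: "u \<in> points" and A: "quantile R u s A"
    and J: "quantile (insert X SS) (S_part (to_model u)) s J"
  shows "A \<subseteq> J"
proof -
  let ?g = "\<lambda>A. if f A \<in> SS then f A else X"
  have "quantile (insert X SS) (push ?g R u) s (?g A)"
  proof (rule quantile_push[OF u finite_R _ _ _ A])
    show "?g A \<subseteq> ?g B" if "A \<in> R" "B \<in> R" "A \<subseteq> B" for A B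
      using f_SS[OF that] f_mono[OF that] SS_R R_X by auto
  qed (use finite_SS f_in in auto)
  then have "J = ?g A"
    using quantile_unique[OF S_part_in[OF to_model_in[OF u]] _ J] finite_SS
    by (auto simp: S_part_to_model[OF u])
  moreover have "A \<in> R" using quantileD[OF u finite_R A] by auto
  ultimately show ?thesis using f_ge[of A] R_X[of A] by auto
qed

text \<open>Undoing the shift, \<open>P\<close> is the image under \<open>f\<close> of the value
  \<open>C\<close> that \<open>u\<close> takes later, at \<open>s\<close> plus the mass of
  \<open>SS\<close>. Hence \<open>A \<subseteq> C \<subseteq> f C = P\<close>.\<close>

lemma below_P_part:
  assumes u: "u \<in> points" and A: "quantile R u s A"
    and P: "quantile (insert X PP) (P_part (to_model u)) s P"
  shows "A \<subseteq> P"
proof (cases "P = X")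
  case True
  then show ?thesis using quantileD(1)[OF u finite_R A] R_X by auto
next
  case False
  then have PP: "P \<in> PP" using P unfolding quantile_def by auto
  \<comment> \<open>Collapsing the spherical values to the bottom element \<open>{}\<close> keeps
    \<open>?g\<close> monotone and places their mass in one initial interval. The parabolic values
    keep the positions they had before the shift.\<close>
  let ?g = "\<lambda>A. if f A \<in> SS then {} else f A"
  let ?w = "to_model u" and ?v = "push ?g R u"
  have w: "?w \<in> model" by (rule to_model_in[OF u])
  have g_PP: "?g A \<in> insert {} PP" if "A \<in> R" for A using that f_in by auto
  have g_mono: "?g A \<subseteq> ?g B" if "A \<in> R" "B \<in> R" "A \<subseteq> B" for A B
    using f_SS[OF that] f_mono[OF that] by auto
  have e: "{} \<notin> PP" "{} \<notin> SS" using empty_notin_R PP_R SS_R by auto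
  have f_ne: "f A \<noteq> {}" if "A \<in> R" for A using f_in[OF that] e by auto
  have v_PP: "?v B = ?w B" if "B \<in> PP" for B
    unfolding push_def to_model_def using that e disj by (intro sum.cong) auto
  have "?v {} = (\<Sum>y | y \<in> R \<and> f y \<in> SS. u y)"
    unfolding push_def using f_ne by (intro sum.cong) auto
  also have "\<dots> = sum ?w SS"
    unfolding to_model_def by (rule sum_push[OF finite_R finite_SS, symmetric])
  finally have v_e: "?v {} = sum ?w SS" .
  have "mass_below (insert {} PP) ?v P = (\<Sum>y\<in>insert {} {y \<in> PP. y \<subset> P}. ?v y)"
    unfolding mass_below_def using PP e by (intro sum.cong) auto
  also have "\<dots> = sum ?w SS + (\<Sum>y | y \<in> PP \<and> y \<subset> P. ?v y)"
    using finite_PP e v_e by (subst sum.insert) auto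
  also have "(\<Sum>y | y \<in> PP \<and> y \<subset> P. ?v y) = mass_below (insert X PP) (P_part ?w) P"
    unfolding mass_below_def using PP PP_R R_X[of P] X_notin v_PP
    by (intro sum.cong) (auto simp: P_part_def)
  finally have shift: "mass_below (insert {} PP) ?v P = sum ?w SS + mass_below (insert X PP) (P_part ?w) P" .
  let ?r = "s + sum ?w SS"
  have q: "quantile (insert {} PP) ?v ?r P"
    using P PP False v_PP[OF PP] unfolding quantile_def shift by (auto simp: P_part_def)
  have v: "?v \<in> chain_points (insert {} PP) (\<subseteq>)"
    using finite_PP by (intro push_chain_points[OF u finite_R] g_PP g_mono) auto
  have nonneg: "0 \<le> sum ?w SS" using chain_pointsD(1)[OF w] by (intro sum_nonneg) auto
  \<comment> \<open>\<open>P\<close> is a value of the step function of \<open>?v\<close> at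
    \<open>?r\<close>, so the shifted position is still in [0, 1) and \<open>u\<close> has a value
    there.\<close>
  have "0 \<le> ?r" "?r < 1" using quantileD[OF v _ q] finite_PP by auto
  then obtain C where C: "quantile R u ?r C" using quantile_ex[OF u finite_R] by blast
  then have "C \<in> R" by (simp add: quantile_def)
  have "quantile (insert {} PP) ?v ?r (?g C)"
    using finite_PP by (intro quantile_push[OF u finite_R _ g_PP g_mono C]) auto
  then have "?g C = P" using quantile_unique[OF v _ _ q] finite_PP by auto
  then have "f C = P" using PP e by (auto split: if_splits)
  moreover have "A \<subseteq> C" using quantile_mono[OF u finite_R A C] nonneg by auto
  ultimately show ?thesis using f_ge[OF \<open>C \<in> R\<close>] by auto
qed

definition truncate :: "real \<Rightarrow> ('a set \<Rightarrow> real) \<Rightarrow> 'a set \<Rightarrow> real" where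
  "truncate t u A = (if A \<in> R then max 0 (min (mass_below R u A + u A) t - mass_below R u A) else 0)"

lemma truncate_nonneg: "truncate t u A \<ge> 0"
  unfolding truncate_def by auto

lemma truncate_nonzeroD: "truncate t u A \<noteq> 0 \<Longrightarrow> \<exists>s<t. quantile R u s A"
  unfolding truncate_def quantile_def
  by (intro exI[of _ "mass_below R u A"]) (auto split: if_splits)

lemma truncate_0: "u \<in> points \<Longrightarrow> truncate 0 u A = 0"
  using mass_below_nonneg[of u R "(\<subseteq>)" A] unfolding truncate_def by auto

lemma truncate_1: "u \<in> points \<Longrightarrow> truncate 1 u A = u A"
  using mass_up_to_le_1[of u R "(\<subseteq>)" A] finite_R chain_pointsD(1,2)[of u R "(\<subseteq>)" A]
  unfolding truncate_def by (auto simp: min_def)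

lemma staircase_1: "w \<in> model \<Longrightarrow> staircase 1 w A = 0"
  by (meson finite_SS finite.insertI not_le quantileD(3) S_part_in staircase_nonzeroD)

text \<open>At time \<open>t\<close> the homotopy between \<open>from_model \<circ> to_model\<close> and the identity uses the step
  function of \<open>u\<close> on \<open>[0, t)\<close> and the one of \<open>from_model (to_model u)\<close> on \<open>[t, 1)\<close>; this is
  monotone because the latter dominates the former.\<close>

definition interpolation :: "real \<Rightarrow> ('a set \<Rightarrow> real) \<Rightarrow> 'a set \<Rightarrow> real" where
  "interpolation t u A = truncate t u A + staircase t (to_model u) A"

lemma interpolation_nonzeroD:
  "interpolation t u A \<noteq> 0 \<Longrightarrow> truncate t u A \<noteq> 0 \<or> staircase t (to_model u) A \<noteq> 0"
  unfolding interpolation_def by auto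

text \<open>\<open>A\<close> is a value of \<open>u\<close> before \<open>t\<close> and
  \<open>B = J \<inter> P\<close> a staircase value at some \<open>r\<close> after it. The value
  \<open>C\<close> of \<open>u\<close> at \<open>r\<close> lies between them.\<close>

lemma truncate_le_staircase:
  assumes u: "u \<in> points" and A: "truncate t u A \<noteq> 0" and B: "staircase t (to_model u) B \<noteq> 0"
  shows "A \<subseteq> B"
proof -
  obtain s where s: "s < t" "quantile R u s A" using truncate_nonzeroD[OF A] by auto
  obtain J P r where JP: "B = J \<inter> P" "t \<le> r"
    and q: "quantile (insert X SS) (S_part (to_model u)) r J"
      "quantile (insert X PP) (P_part (to_model u)) r P"
    using B by (rule staircase_nonzeroD)
  have "0 \<le> r" "r < 1" using quantileD(2,3)[OF S_part_in[OF to_model_in[OF u]] _ q(1)] finite_SS by auto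
  then obtain C where C: "quantile R u r C" using quantile_ex[OF u finite_R] by blast
  have "A \<subseteq> C" using quantile_mono[OF u finite_R s(2) C] s JP by auto
  then show ?thesis using below_S_part[OF u C q(1)] below_P_part[OF u C q(2)] JP by auto
qed

lemma interpolation_chain:
  assumes u: "u \<in> points" and "interpolation t u A \<noteq> 0" "interpolation t u B \<noteq> 0"
  shows "A \<subseteq> B \<or> B \<subseteq> A"
proof -
  have "A \<subseteq> B \<or> B \<subseteq> A" if "truncate t u A \<noteq> 0" "truncate t u B \<noteq> 0"
  proof -
    have "u A \<noteq> 0" "u B \<noteq> 0"
      using that truncate_nonzeroD quantileD(4)[OF u finite_R] by force+
    then show ?thesis by (rule chain_pointsD(4)[OF u])
  qed
  then show ?thesis
    using assms(2,3)[THEN interpolation_nonzeroD] truncate_le_staircase[OF u]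
      staircase_chain[OF to_model_in[OF u]] by blast
qed

text \<open>The total may be less than 1 because the staircase has its end cut off. It cannot
  vanish: for positive \<open>t\<close> the first value of \<open>u\<close> contributes, and for
  \<open>t = 0\<close> the staircase is complete.\<close>

lemma sum_interpolation_pos:
  assumes u: "u \<in> points" and "0 \<le> t"
  shows "sum (interpolation t u) R > 0"
proof (cases "t = 0")
  case True
  then show ?thesis
    using sum_staircase_pos[OF to_model_in[OF u]] truncate_0[OF u]
    by (simp add: interpolation_def)
next
  case False
  obtain A where A: "quantile R u 0 A" using quantile_ex[OF u finite_R, of 0] by auto
  then have "truncate t u A > 0"
    using False \<open>0 \<le> t\<close> unfolding truncate_def quantile_def by auto
  then have "interpolation t u A > 0"
    using staircase_nonneg[of t "to_model u" A] unfolding interpolation_def by linarith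
  then show ?thesis using A finite_R unfolding quantile_def
    by (intro sum_pos2[of _ A])
      (auto simp: interpolation_def staircase_nonneg truncate_nonneg)
qed

lemma homotopic_from_to: "homotopic_with_canon (\<lambda>_. True) points points (from_model \<circ> to_model) id"
proof (rule homotopic_withI_top_of_set)
  let ?h = "\<lambda>q. normalise R (interpolation (fst q) (snd q))"
  have "continuous_on S (\<lambda>q::real \<times> ('a set \<Rightarrow> real). to_model (snd q))" for S
    by (intro continuous_on_compose2[OF continuous_to_model[of UNIV]] continuous_on_snd
        continuous_on_id) auto
  then have m: "continuous_on S (\<lambda>q::real \<times> ('a set \<Rightarrow> real). to_model (snd q) A)" for S A
    by (rule continuous_on_product_then_coordinatewise)
  have tr: "continuous_on S (\<lambda>q. truncate (fst q) (snd q) A)" for S A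
    unfolding truncate_def
    by (cases "A \<in> R") (auto intro!: continuous_on_max continuous_on_min continuous_on_diff
        continuous_on_add continuous_on_mass_below continuous_on_snd_eval continuous_on_fst)
  show "continuous_on ({0..1} \<times> points) ?h"
    unfolding interpolation_def
  proof (intro continuous_on_normalise continuous_on_add tr continuous_on_staircase m
      continuous_on_fst continuous_on_id)
    show "(\<Sum>A\<in>R. truncate (fst q) (snd q) A + staircase (fst q) (to_model (snd q)) A) \<noteq> 0"
      if "q \<in> {0..1} \<times> points" for q
      using sum_interpolation_pos[of "snd q" "fst q"] that unfolding interpolation_def by auto
  qed
  show "?h (t, u) \<in> points" if "t \<in> {0..1}" "u \<in> points" for t u
  proof -
    have "interpolation t u A \<noteq> 0 \<Longrightarrow> A \<in> R" for A
      using interpolation_nonzeroD[of t u A] staircase_R by (auto simp: truncate_def split: if_splits)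
    then show ?thesis
      using that sum_interpolation_pos[of u t] interpolation_chain[OF that(2), of t]
      by (intro normalise_chain_points)
        (auto simp: interpolation_def truncate_nonneg staircase_nonneg)
  qed
  show "?h (0, u) = (from_model \<circ> to_model) u" if "u \<in> points" for u
    using that by (simp add: interpolation_def[abs_def] truncate_0 from_model_def)
  show "?h (1, u) = id u" if "u \<in> points" for u
    using that normalise_id[OF that]
    by (simp add: interpolation_def[abs_def] truncate_1 staircase_1 to_model_in)
qed

theorem homotopy_equivalent_model: "top_of_set points homotopy_equivalent_space top_of_set model"
  unfolding homotopy_equivalent_space_def
proof (intro exI conjI)
  show "continuous_map (top_of_set points) (top_of_set model) to_model"
    using continuous_to_model to_model_in by auto
  show "continuous_map (top_of_set model) (top_of_set points) from_model"
    using continuous_from_model from_model_in by auto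
qed (rule homotopic_from_to homotopic_to_from)+

end

subsection \<open>Joins\<close>

text \<open>All three preimages commute with intersections and unions. Without this fact nothing can
  be read off from \<open>topology\<close> in the definition of \<open>join_space\<close>.\<close>

lemma istopology_join:
  "istopology (\<lambda>U. U \<subseteq> join_carrier X Y \<and>
     openin X {x \<in> topspace X. JL x \<in> U} \<and>
     openin Y {y \<in> topspace Y. JR y \<in> U} \<and>
     openin (prod_topology X (prod_topology Y (top_of_set {0..1::real})))
        {(x, y, t). x \<in> topspace X \<and> y \<in> topspace Y \<and> t \<in> {0..1} \<and> join_quot x y t \<in> U})"
    (is "istopology (\<lambda>U. ?c U \<and> openin X (?l U) \<and> openin Y (?r U) \<and> openin ?Z (?m U))")
  unfolding istopology_def
proof (intro conjI allI impI)
  fix U V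
  assume U: "?c U \<and> openin X (?l U) \<and> openin Y (?r U) \<and> openin ?Z (?m U)"
    and V: "?c V \<and> openin X (?l V) \<and> openin Y (?r V) \<and> openin ?Z (?m V)"
  have "?l (U \<inter> V) = ?l U \<inter> ?l V" "?r (U \<inter> V) = ?r U \<inter> ?r V" "?m (U \<inter> V) = ?m U \<inter> ?m V"
    by auto
  then show "?c (U \<inter> V)" "openin X (?l (U \<inter> V))" "openin Y (?r (U \<inter> V))" "openin ?Z (?m (U \<inter> V))"
    using U V by (auto simp only: openin_Int)
next
  fix K
  assume K: "\<forall>U\<in>K. ?c U \<and> openin X (?l U) \<and> openin Y (?r U) \<and> openin ?Z (?m U)"
  have "?l (\<Union>K) = \<Union>(?l ` K)" "?r (\<Union>K) = \<Union>(?r ` K)" "?m (\<Union>K) = \<Union>(?m ` K)"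
    by auto
  then show "openin X (?l (\<Union>K))" "openin Y (?r (\<Union>K))" "openin ?Z (?m (\<Union>K))"
    using K by (simp_all only:) (auto intro!: openin_Union)
  show "?c (\<Union>K)" using K by auto
qed

lemmas openin_join_space = topology_inverse'[OF istopology_join, folded join_space_def]

lemma join_quot_in_carrier:
  "x \<in> topspace X \<Longrightarrow> y \<in> topspace Y \<Longrightarrow> t \<in> {0..1} \<Longrightarrow> join_quot x y t \<in> join_carrier X Y"
  unfolding join_quot_def join_carrier_def by auto

lemma topspace_join_space [simp]: "topspace (join_space X Y) = join_carrier X Y"
proof
  show "topspace (join_space X Y) \<subseteq> join_carrier X Y"
    unfolding topspace_def openin_join_space by auto
  have "{x \<in> topspace X. JL x \<in> join_carrier X Y} = topspace X"
    "{y \<in> topspace Y. JR y \<in> join_carrier X Y} = topspace Y"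
    by (auto simp: join_carrier_def)
  moreover have "{(x, y, t). x \<in> topspace X \<and> y \<in> topspace Y \<and> t \<in> {0..1} \<and>
      join_quot x y t \<in> join_carrier X Y} = topspace (prod_topology X (prod_topology Y (top_of_set {0..1})))"
    by (auto intro: join_quot_in_carrier)
  ultimately have "openin (join_space X Y) (join_carrier X Y)"
    unfolding openin_join_space by (simp only: openin_topspace) auto
  then show "join_carrier X Y \<subseteq> topspace (join_space X Y)" by (rule openin_subset)
qed

lemma continuous_map_JL: "continuous_map X (join_space X Y) JL"
  unfolding continuous_map_def openin_join_space by (auto simp: join_carrier_def)

lemma continuous_map_JR: "continuous_map Y (join_space X Y) JR"
  unfolding continuous_map_def openin_join_space by (auto simp: join_carrier_def)

lemma continuous_map_join_quot:
  "continuous_map (prod_topology X (prod_topology Y (top_of_set {0..1}))) (join_space X Y)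
     (\<lambda>(x, y, t). join_quot x y t)"
proof -
  have "{q \<in> topspace (prod_topology X (prod_topology Y (top_of_set {0..1::real}))).
        (case q of (x, y, t) \<Rightarrow> join_quot x y t) \<in> U} =
      {(x, y, t). x \<in> topspace X \<and> y \<in> topspace Y \<and> t \<in> {0..1} \<and> join_quot x y t \<in> U}" for U
    by auto
  then show ?thesis
    unfolding continuous_map_def openin_join_space by (auto intro: join_quot_in_carrier)
qed

text \<open>The universal property of the quotient. The two ends have hypotheses of their own
  because the cylinder does not reach them when the other factor is empty.\<close>

lemma continuous_map_from_join_space:
  assumes "continuous_map X Z (\<lambda>x. g (JL x))" "continuous_map Y Z (\<lambda>y. g (JR y))"
    and "continuous_map (prod_topology X (prod_topology Y (top_of_set {0..1}))) Z
      (\<lambda>(x, y, t). g (join_quot x y t))"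
  shows "continuous_map (join_space X Y) Z g"
  unfolding continuous_map_def openin_join_space
proof (intro conjI allI impI)
  show "g \<in> topspace (join_space X Y) \<rightarrow> topspace Z"
  proof
    fix z assume "z \<in> topspace (join_space X Y)"
    then have z: "z \<in> join_carrier X Y" by simp
    show "g z \<in> topspace Z"
    proof (cases z)
      case (JL x)
      then show ?thesis using z assms(1) by (auto simp: join_carrier_def continuous_map_def)
    next
      case (JR y)
      then show ?thesis using z assms(2) by (auto simp: join_carrier_def continuous_map_def)
    next
      case (JM x y t)
      then have "(x, y, t) \<in> topspace (prod_topology X (prod_topology Y (top_of_set {0..1})))"
        and q: "join_quot x y t = z"
        using z by (auto simp: join_carrier_def join_quot_def)
      then have "(case (x, y, t) of (x, y, t) \<Rightarrow> g (join_quot x y t)) \<in> topspace Z"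
        using assms(3) unfolding continuous_map_def by blast
      then show ?thesis using q by simp
    qed
  qed
next
  fix U assume U: "openin Z U"
  have "{x \<in> topspace X. JL x \<in> {z \<in> topspace (join_space X Y). g z \<in> U}} = {x \<in> topspace X. g (JL x) \<in> U}"
    "{y \<in> topspace Y. JR y \<in> {z \<in> topspace (join_space X Y). g z \<in> U}} = {y \<in> topspace Y. g (JR y) \<in> U}"
    by (auto simp: join_carrier_def)
  then show "openin X {x \<in> topspace X. JL x \<in> {z \<in> topspace (join_space X Y). g z \<in> U}}"
    "openin Y {y \<in> topspace Y. JR y \<in> {z \<in> topspace (join_space X Y). g z \<in> U}}"
    using openin_continuous_map_preimage[OF assms(1) U] openin_continuous_map_preimage[OF assms(2) U]
    by simp_all
  have "{(x, y, t). x \<in> topspace X \<and> y \<in> topspace Y \<and> t \<in> {0..1} \<and>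
      join_quot x y t \<in> {z \<in> topspace (join_space X Y). g z \<in> U}} =
    {q \<in> topspace (prod_topology X (prod_topology Y (top_of_set {0..1}))).
      (case q of (x, y, t) \<Rightarrow> g (join_quot x y t)) \<in> U}"
    by (auto intro: join_quot_in_carrier)
  then show "openin (prod_topology X (prod_topology Y (top_of_set {0..1}))) {(x, y, t). x \<in> topspace X \<and> y \<in> topspace Y \<and> t \<in> {0..1} \<and>
      join_quot x y t \<in> {z \<in> topspace (join_space X Y). g z \<in> U}}"
    using openin_continuous_map_preimage[OF assms(3) U] by simp
qed auto

text \<open>The join is covered by the continuous images of three compact spaces: the two factors
  and the cylinder.\<close>

lemma compact_space_join_space:
  assumes "compact_space X" "compact_space Y"
  shows "compact_space (join_space X Y)"
proof -
  let ?Z = "prod_topology X (prod_topology Y (top_of_set {0..1::real}))"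
  have "compact_space ?Z"
    using assms by (simp add: compact_space_prod_topology compact_space_subtopology)
  then have "compactin (join_space X Y) (JL ` topspace X \<union> JR ` topspace Y \<union>
      (\<lambda>(x, y, t). join_quot x y t) ` topspace ?Z)"
    using assms unfolding compact_space_def
    by (intro compactin_Un image_compactin[OF _ continuous_map_JL] image_compactin[OF _ continuous_map_JR]
        image_compactin[OF _ continuous_map_join_quot])
  also have "JL ` topspace X \<union> JR ` topspace Y \<union> (\<lambda>(x, y, t). join_quot x y t) ` topspace ?Z
      = topspace (join_space X Y)"
  proof (intro equalityI subsetI)
    fix z assume "z \<in> topspace (join_space X Y)"
    then have z: "z \<in> join_carrier X Y" by simp
    show "z \<in> JL ` topspace X \<union> JR ` topspace Y \<union> (\<lambda>(x, y, t). join_quot x y t) ` topspace ?Z"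
    proof (cases z)
      case (JM x y t)
      then have "(x, y, t) \<in> topspace ?Z" "z = (\<lambda>(x, y, t). join_quot x y t) (x, y, t)"
        using z by (auto simp: join_carrier_def join_quot_def)
      then show ?thesis by blast
    qed (use z in \<open>auto simp: join_carrier_def\<close>)
  next
    fix z assume "z \<in> JL ` topspace X \<union> JR ` topspace Y \<union> (\<lambda>(x, y, t). join_quot x y t) ` topspace ?Z"
    then show "z \<in> topspace (join_space X Y)"
      by (auto intro: join_quot_in_carrier) (auto simp: join_carrier_def)
  qed
  finally show ?thesis unfolding compact_space_def .
qed

text \<open>A closed subset of a cube, which is compact by Tychonoff's theorem even if the index
  type is infinite.\<close>

lemma compact_space_chain_points:
  assumes "finite P" shows "compact_space (top_of_set (chain_points P rel))"
proof -
  have ev: "continuous_on UNIV (\<lambda>f::'x \<Rightarrow> real. f x)" for x by (rule continuous_on_eval)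
  \<comment> \<open>The chain condition becomes closed when stated as \<open>f x * f y = 0\<close>
    for incomparable \<open>x\<close> and \<open>y\<close>.\<close>
  have eq: "chain_points P rel = {f. \<forall>x. 0 \<le> f x} \<inter> (\<Inter>x\<in>-P. {f. f x = 0}) \<inter> {f. (\<Sum>x\<in>P. f x) = 1} \<inter>
      (\<Inter>(x, y)\<in>{(x, y). \<not> (rel x y \<or> rel y x)}. {f. f x * f y = 0})"
    unfolding chain_points_def by auto
  have "closed (chain_points P rel)"
    unfolding eq case_prod_beta
    by (intro closed_Int closed_INT ballI closed_Collect_all closed_Collect_le closed_Collect_eq
        continuous_on_const continuous_on_sum continuous_on_mult ev)
  then have "closedin (powertop_real UNIV) (chain_points P rel)"
    by (simp add: euclidean_product_topology)
  moreover have "f x \<le> 1" if "f \<in> chain_points P rel" for f x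
  proof (cases "x \<in> P")
    case True
    then have "f x \<le> sum f P"
      using chain_pointsD(1)[OF that] assms by (intro member_le_sum) auto
    then show ?thesis using chain_pointsD(3)[OF that] by simp
  next
    case False
    then show ?thesis using chain_pointsD(2)[OF that, of x] by force
  qed
  then have "f \<in> (\<Pi>\<^sub>E x\<in>UNIV. {0..1})" if "f \<in> chain_points P rel" for f
    using that chain_pointsD(1)[OF that] by (simp add: PiE_iff)
  then have "chain_points P rel \<subseteq> (\<Pi>\<^sub>E x\<in>UNIV. {0..1})" by blast
  moreover have "compactin (powertop_real UNIV) (\<Pi>\<^sub>E x\<in>UNIV. {0..1::real})"
    unfolding compactin_PiE by simp
  ultimately have "compactin (powertop_real UNIV) (chain_points P rel)"
    using closed_compactin by blast
  then show ?thesis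
    by (simp add: euclidean_product_topology compact_space_subtopology)
qed

section \<open>The realisation of an ordinal sum as a join\<close>

lemma Hausdorff_space_function: "Hausdorff_space (top_of_set (A :: ('x \<Rightarrow> real) set))"
  unfolding euclidean_product_topology[symmetric]
  by (intro Hausdorff_space_subtopology) (simp add: Hausdorff_space_product_topology)

fun join_eval :: "('b \<Rightarrow> 'x \<Rightarrow> real) \<Rightarrow> ('b, 'x \<Rightarrow> real) joinpt \<Rightarrow> 'x \<Rightarrow> real" where
  "join_eval h (JL x) = h x"
| "join_eval h (JR y) = y"
| "join_eval h (JM x y t) = (\<lambda>z. (1 - t) * h x z + t * y z)"

lemma join_eval_quot: "join_eval h (join_quot x y t) = (\<lambda>z. (1 - t) * h x z + t * y z)"
  unfolding join_quot_def by auto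

text \<open>Each summand is constrained only where its coefficient is nonzero, which also covers the
  two ends of the join. The second claim recovers the join parameter as the mass of
  \<open>P\<close>.\<close>

lemma mix_in_tier:
  assumes fin: "finite S" "finite P" and disj: "S \<inter> P = {}" and t: "0 \<le> t" "t \<le> 1"
    and a: "t < 1 \<Longrightarrow> a \<in> chain_points S (\<le>)" and b: "0 < t \<Longrightarrow> b \<in> chain_points P (\<le>)"
  shows "(\<lambda>z. (1 - t) * a z + t * b z) \<in> chain_points (S \<union> P) (tier S)"
    and "(\<Sum>z\<in>P. (1 - t) * a z + t * b z) = t"
proof -
  let ?m = "\<lambda>z. (1 - t) * a z + t * b z"
  have ta: "0 \<le> (1 - t) * a z" "(1 - t) * a z \<noteq> 0 \<Longrightarrow> z \<in> S \<and> a z \<noteq> 0 \<and> t < 1" for z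
    using a t chain_pointsD(1,2)[of a S "(\<le>)" z] by (cases "t < 1"; force)+
  have tb: "0 \<le> t * b z" "t * b z \<noteq> 0 \<Longrightarrow> z \<in> P \<and> b z \<noteq> 0 \<and> 0 < t" for z
    using b t chain_pointsD(1,2)[of b P "(\<le>)" z] by (cases "0 < t"; force)+
  have "(\<Sum>z\<in>P. t * b z) = t"
    using b t chain_pointsD(3)[of b P "(\<le>)"]
    by (cases "t = 0") (auto simp: sum_distrib_left[symmetric])
  moreover have "(\<Sum>z\<in>P. (1 - t) * a z) = 0"
    using ta(2) disj by (intro sum.neutral) blast
  ultimately show P: "sum ?m P = t" by (simp add: sum.distrib)
  have "(\<Sum>z\<in>S. (1 - t) * a z) = 1 - t"
    using a t chain_pointsD(3)[of a S "(\<le>)"]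
    by (cases "t = 1") (auto simp: sum_distrib_left[symmetric])
  moreover have "(\<Sum>z\<in>S. t * b z) = 0"
    using tb(2) disj by (intro sum.neutral) blast
  ultimately have S: "sum ?m S = 1 - t" by (simp add: sum.distrib)
  show "?m \<in> chain_points (S \<union> P) (tier S)"
  proof (rule chain_pointsI)
    show "?m z \<ge> 0" for z using ta(1)[of z] tb(1)[of z] by simp
    have nz: "z \<in> S \<and> a z \<noteq> 0 \<and> t < 1 \<or> z \<in> P \<and> b z \<noteq> 0 \<and> 0 < t" if "?m z \<noteq> 0" for z
      using that ta(2)[of z] tb(2)[of z] by fastforce
    then show "?m z \<noteq> 0 \<Longrightarrow> z \<in> S \<union> P" for z by blast
    show "sum ?m (S \<union> P) = 1" using S P fin disj by (simp add: sum.union_disjoint)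
    show "tier S x y \<or> tier S y x" if "?m x \<noteq> 0" "?m y \<noteq> 0" for x y
      using nz[OF that(1)] nz[OF that(2)] disj chain_pointsD(4)[OF a] chain_pointsD(4)[OF b]
      unfolding tier_def by blast
  qed
qed

text \<open>\<open>join_eval\<close> is a continuous bijection from a compact to a Hausdorff space.
  As \<open>X\<close> need only be homeomorphic to a realisation, the sphere can be inserted
  directly, without proving that joins respect homeomorphisms.\<close>

lemma join_space_chain_points:
  fixes S P :: "'x::order set"
  assumes fin: "finite S" "finite P" and disj: "S \<inter> P = {}"
    and X: "X homeomorphic_space top_of_set (chain_points S (\<le>))"
  shows "join_space X (top_of_set (chain_points P (\<le>))) homeomorphic_space
    top_of_set (chain_points (S \<union> P) (tier S))"
proof -
  let ?Y = "top_of_set (chain_points P (\<le>))"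
  let ?T = "top_of_set (chain_points (S \<union> P) (tier S))"
  obtain h where h: "homeomorphic_map X (top_of_set (chain_points S (\<le>))) h"
    using X homeomorphic_space by blast
  have h_cont: "continuous_map X (top_of_set (chain_points S (\<le>))) h"
    using h homeomorphic_imp_continuous_map by blast
  have h_img: "h ` topspace X = chain_points S (\<le>)"
    using homeomorphic_imp_surjective_map[OF h] by simp
  have h_inj: "inj_on h (topspace X)"
    using homeomorphic_imp_injective_map[OF h] .
  have hx: "h x \<in> chain_points S (\<le>)" if "x \<in> topspace X" for x using that h_img by auto
  have cpt: "compact_space X"
    using homeomorphic_compact_space[OF X] compact_space_chain_points[OF fin(1)] by blast
  note mix = mix_in_tier[OF fin disj]
  have L: "h x \<in> chain_points (S \<union> P) (tier S)" "sum (h x) P = 0" if "x \<in> topspace X" for x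
    using mix[of 0 "h x"] hx[OF that] by simp_all
  have R: "y \<in> chain_points (S \<union> P) (tier S)" "sum y P = 1" if "y \<in> chain_points P (\<le>)" for y
    using mix[of 1 _ y] that by simp_all
  have M: "(\<lambda>z. (1 - t) * h x z + t * y z) \<in> chain_points (S \<union> P) (tier S)"
    "(\<Sum>z\<in>P. (1 - t) * h x z + t * y z) = t"
    if "x \<in> topspace X" "y \<in> chain_points P (\<le>)" "0 \<le> t" "t \<le> 1" for x y t
    using mix[of t "h x" y] hx[OF that(1)] that by simp_all
  have "continuous_map (join_space X ?Y) ?T (join_eval h)"
  proof (rule continuous_map_from_join_space)
    show "continuous_map X ?T (\<lambda>x. join_eval h (JL x))"
      using h_cont L(1) by (auto simp: continuous_map_in_subtopology)
    show "continuous_map ?Y ?T (\<lambda>y. join_eval h (JR y))"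
      using R(1) by (auto simp: continuous_map_in_subtopology)
    let ?Z = "prod_topology X (prod_topology ?Y (top_of_set {0..1::real}))"
    have "continuous_map ?Z euclideanreal (\<lambda>q. (1 - snd (snd q)) * h (fst q) z + snd (snd q) * fst (snd q) z)" for z
    proof -
      have ev: "continuous_map (top_of_set A) euclideanreal (\<lambda>f. f z)" for A :: "('x \<Rightarrow> real) set"
        by (simp add: continuous_on_eval)
      have 1: "continuous_map ?Z euclideanreal ((\<lambda>f. f z) \<circ> (h \<circ> fst))"
        by (rule continuous_map_compose[OF continuous_map_compose[OF continuous_map_fst h_cont] ev])
      have 2: "continuous_map ?Z euclideanreal ((\<lambda>f. f z) \<circ> (fst \<circ> snd))"
        by (rule continuous_map_compose[OF continuous_map_fst_of[OF continuous_map_snd] ev])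
      have "continuous_map ?Z (top_of_set {0..1}) (snd \<circ> snd)"
        by (rule continuous_map_snd_of[OF continuous_map_snd])
      then have 3: "continuous_map ?Z euclideanreal (snd \<circ> snd)"
        by (simp add: continuous_map_in_subtopology)
      from 1 2 3 show ?thesis unfolding o_def
        by (intro continuous_map_add continuous_map_real_mult continuous_map_diff) auto
    qed
    then have "continuous_map ?Z euclidean (\<lambda>(x, y, t) z. (1 - t) * h x z + t * y z)"
      unfolding euclidean_product_topology[symmetric] continuous_map_componentwise_UNIV case_prod_beta by simp
    then show "continuous_map ?Z ?T (\<lambda>(x, y, t). join_eval h (join_quot x y t))"
      unfolding join_eval_quot using M(1) by (auto simp: continuous_map_in_subtopology)
  qed
  moreover have "join_eval h ` topspace (join_space X ?Y) = topspace ?T"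
  proof (intro equalityI subsetI)
    fix w assume "w \<in> join_eval h ` topspace (join_space X ?Y)"
    then show "w \<in> topspace ?T" using L(1) R(1) M(1) by (fastforce simp: join_carrier_def)
  next
    fix w assume "w \<in> topspace ?T"
    then have w: "w \<in> chain_points (S \<union> P) (tier S)" by simp
    define t where "t = sum w P"
    have nonneg: "\<And>z. w z \<ge> 0" by (rule chain_pointsD(1)[OF w])
    have S1: "sum w S = 1 - t"
      using chain_pointsD(3)[OF w] sum.union_disjoint[OF fin disj, of w] unfolding t_def by simp
    have t: "0 \<le> t" "t \<le> 1"
      using S1 sum_nonneg[of S w] sum_nonneg[of P w] nonneg by (auto simp: t_def)
    \<comment> \<open>At \<open>t = 1\<close> this is the zero function, since division by zero
      gives 0; the same holds for \<open>b\<close> at \<open>t = 0\<close>. The coefficient in front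
      is then 0 as well.\<close>
    define a where "a z = (if z \<in> S then w z / (1 - t) else 0)" for z
    define b where "b z = (if z \<in> P then w z / t else 0)" for z
    have supp: "z \<in> S \<union> P" if "w z \<noteq> 0" for z using chain_pointsD(2)[OF w that] .
    have a: "a \<in> chain_points S (\<le>)" if "t < 1"
    proof (rule chain_pointsI)
      have "sum a S = sum w S / (1 - t)" by (simp add: a_def sum_divide_distrib)
      then show "sum a S = 1" using S1 that by simp
      show "x \<le> y \<or> y \<le> x" if "a x \<noteq> 0" "a y \<noteq> 0" for x y
        using that chain_pointsD(4)[OF w, of x y] by (auto simp: a_def tier_def split: if_splits)
    qed (use that nonneg in \<open>auto simp: a_def split: if_splits\<close>)
    have b: "b \<in> chain_points P (\<le>)" if "0 < t"
    proof (rule chain_pointsI)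
      have "sum b P = sum w P / t" by (simp add: b_def sum_divide_distrib)
      then show "sum b P = 1" using that by (simp add: t_def)
      show "x \<le> y \<or> y \<le> x" if "b x \<noteq> 0" "b y \<noteq> 0" for x y
        using that chain_pointsD(4)[OF w, of x y] disj by (auto simp: b_def tier_def split: if_splits)
    qed (use that nonneg in \<open>auto simp: b_def split: if_splits\<close>)
    have w0: "w z = 0" if "t = 0" "z \<in> P" for z
      using that sum_nonneg_eq_0_iff[OF fin(2), of w] nonneg by (auto simp: t_def)
    have w1: "w z = 0" if "t = 1" "z \<in> S" for z
      using that S1 sum_nonneg_eq_0_iff[OF fin(1), of w] nonneg by auto
    have eq: "w = (\<lambda>z. (1 - t) * a z + t * b z)"
    proof
      fix z show "w z = (1 - t) * a z + t * b z"
        using supp[of z] w0[of z] w1[of z] disj by (auto simp: a_def b_def)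
    qed
    \<comment> \<open>For \<open>t = 1\<close> the space \<open>X\<close> may be empty, so
      \<open>x\<close> is constrained only for smaller \<open>t\<close>.\<close>
    obtain x where x: "t < 1 \<Longrightarrow> x \<in> topspace X \<and> h x = a"
      using a h_img by (metis imageE)
    consider "t = 0" | "t = 1" | "0 < t" "t < 1" using t by linarith
    then show "w \<in> join_eval h ` topspace (join_space X ?Y)"
    proof cases
      case 1
      then show ?thesis using x eq
        by (intro image_eqI[of _ _ "JL x"]) (auto simp: join_carrier_def)
    next
      case 2
      then show ?thesis using b eq
        by (intro image_eqI[of _ _ "JR b"]) (auto simp: join_carrier_def)
    next
      case 3
      then show ?thesis using x b eq
        by (intro image_eqI[of _ _ "JM x b t"]) (auto simp: join_carrier_def)
    qed
  qed
  moreover have "inj_on (join_eval h) (topspace (join_space X ?Y))"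
  proof (rule inj_onI)
    \<comment> \<open>The two summands have disjoint supports, so each coordinate sees only one of
      them, with nonzero coefficient.\<close>
    have sep: "x = x' \<and> y = y'"
      if x: "x \<in> topspace X" "x' \<in> topspace X" and y: "y \<in> chain_points P (\<le>)" "y' \<in> chain_points P (\<le>)"
        and t: "0 < t" "t < 1"
        and eq: "(\<lambda>z. (1 - t) * h x z + t * y z) = (\<lambda>z. (1 - t) * h x' z + t * y' z)" for x x' y y' t
    proof -
      have "h x z = h x' z \<and> y z = y' z" for z
      proof -
        have "z \<notin> S \<longrightarrow> h x z = 0 \<and> h x' z = 0" "z \<notin> P \<longrightarrow> y z = 0 \<and> y' z = 0"
          using chain_pointsD(2)[OF hx[OF x(1)], of z] chain_pointsD(2)[OF hx[OF x(2)], of z]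
            chain_pointsD(2)[OF y(1), of z] chain_pointsD(2)[OF y(2), of z] by auto
        moreover have "z \<notin> S \<or> z \<notin> P" using disj by blast
        ultimately show ?thesis using fun_cong[OF eq, of z] t by auto
      qed
      then have "h x = h x'" "y = y'" by auto
      then show ?thesis using h_inj x by (auto dest: inj_onD)
    qed
    have mem: "JL x \<in> topspace (join_space X ?Y) \<longleftrightarrow> x \<in> topspace X"
      "JR y \<in> topspace (join_space X ?Y) \<longleftrightarrow> y \<in> chain_points P (\<le>)"
      "JM x y t \<in> topspace (join_space X ?Y) \<longleftrightarrow> x \<in> topspace X \<and> y \<in> chain_points P (\<le>) \<and> 0 < t \<and> t < 1"
      for x y t
      by (auto simp: join_carrier_def)
    fix z z' assume z: "z \<in> topspace (join_space X ?Y)" and z': "z' \<in> topspace (join_space X ?Y)"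
      and eq: "join_eval h z = join_eval h z'"
    \<comment> \<open>The mass on \<open>P\<close> is 0 on \<open>JL\<close>, 1 on \<open>JR\<close>
      and \<open>t\<close> on \<open>JM\<close>, which rules out equal values for different
      constructors and determines \<open>t\<close>.\<close>
    then have sums: "sum (join_eval h z) P = sum (join_eval h z') P" by simp
    show "z = z'"
    proof (cases z)
      case [simp]: (JL x)
      have x: "x \<in> topspace X" using z by (simp only: JL mem)
      show ?thesis
      proof (cases z')
        case [simp]: (JL x')
        have "x' \<in> topspace X" using z' by (simp only: JL mem)
        then show ?thesis using inj_onD[OF h_inj _ x] eq by simp
      next
        case [simp]: (JR y')
        have "y' \<in> chain_points P (\<le>)" using z' by (simp only: JR mem)
        then show ?thesis using sums L(2)[OF x] R(2) by simp
      next
        case [simp]: (JM x' y' t')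
        have "x' \<in> topspace X" "y' \<in> chain_points P (\<le>)" "0 < t'" "t' < 1"
          using z' by (simp_all only: JM mem)
        then show ?thesis using sums L(2)[OF x] M(2)[of x' y' t'] by simp
      qed
    next
      case [simp]: (JR y)
      have y: "y \<in> chain_points P (\<le>)" using z by (simp only: JR mem)
      show ?thesis
      proof (cases z')
        case [simp]: (JL x')
        have "x' \<in> topspace X" using z' by (simp only: JL mem)
        then show ?thesis using sums R(2)[OF y] L(2)[of x'] by simp
      next
        case (JR y')
        then show ?thesis using eq by simp
      next
        case [simp]: (JM x' y' t')
        have "x' \<in> topspace X" "y' \<in> chain_points P (\<le>)" "0 < t'" "t' < 1"
          using z' by (simp_all only: JM mem)
        then show ?thesis using sums R(2)[OF y] M(2)[of x' y' t'] by simp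
      qed
    next
      case [simp]: (JM x y t)
      have xyt: "x \<in> topspace X" "y \<in> chain_points P (\<le>)" "0 < t" "t < 1"
        using z by (simp_all only: JM mem)
      show ?thesis
      proof (cases z')
        case [simp]: (JL x')
        have "x' \<in> topspace X" using z' by (simp only: JL mem)
        then show ?thesis using sums M(2)[of x y t] xyt L(2)[of x'] by simp
      next
        case [simp]: (JR y')
        have "y' \<in> chain_points P (\<le>)" using z' by (simp only: JR mem)
        then show ?thesis using sums M(2)[of x y t] xyt R(2)[of y'] by simp
      next
        case [simp]: (JM x' y' t')
        have xyt': "x' \<in> topspace X" "y' \<in> chain_points P (\<le>)" "0 < t'" "t' < 1"
          using z' by (simp_all only: JM mem)
        then have "t = t'" using sums M(2)[of x y t] M(2)[of x' y' t'] xyt by simp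
        then show ?thesis using sep[of x x' y y' t] xyt xyt' eq by simp
      qed
    qed
  qed
  ultimately have "homeomorphic_map (join_space X ?Y) ?T (join_eval h)"
    by (intro continuous_imp_homeomorphic_map Hausdorff_space_function
        compact_space_join_space cpt compact_space_chain_points fin(2))
  then show ?thesis by (rule homeomorphic_map_imp_homeomorphic_space)
qed

subsection \<open>The boundary of a simplex\<close>

text \<open>The support sets that do not contain \<open>I\<close> form a chain; some
  \<open>i\<close> in \<open>I\<close> is missing from the largest of them, hence from all. So the
  mass of the supersets of \<open>I\<close> is the least coordinate over \<open>I\<close>.\<close>

lemma superset_sum_attained:
  fixes f :: "'x::order \<Rightarrow> real" and s :: "'x \<Rightarrow> nat set"
  assumes f: "f \<in> chain_points U (\<le>)" and "finite U" and mono: "\<And>A B. A \<in> U \<Longrightarrow> B \<in> U \<Longrightarrow> A \<le> B \<Longrightarrow> s A \<subseteq> s B"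
    and "I \<noteq> {}"
  shows "\<exists>i\<in>I. (\<Sum>A | A \<in> U \<and> i \<in> s A. f A) = (\<Sum>A | A \<in> U \<and> I \<subseteq> s A. f A)"
proof -
  define T where "T = {A \<in> U. f A \<noteq> 0 \<and> \<not> I \<subseteq> s A}"
  have "\<exists>i\<in>I. \<forall>A\<in>T. i \<notin> s A"
  proof (cases "T = {}")
    case False
    moreover have "finite T" using \<open>finite U\<close> by (simp add: T_def)
    ultimately obtain m where m: "m \<in> T" "\<And>A. A \<in> T \<Longrightarrow> m \<le> A \<Longrightarrow> m = A"
      using finite_has_maximal by metis
    then obtain i where i: "i \<in> I" "i \<notin> s m" by (auto simp: T_def)
    have "A \<le> m" if "A \<in> T" for A
      using chain_pointsD(4)[OF f, of A m] m that by (auto simp: T_def)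
    then have "s A \<subseteq> s m" if "A \<in> T" for A using that m(1) mono by (auto simp: T_def)
    then show ?thesis using i by blast
  qed (use \<open>I \<noteq> {}\<close> in auto)
  then obtain i where i: "i \<in> I" "\<And>A. A \<in> T \<Longrightarrow> i \<notin> s A" by blast
  have "(\<Sum>A | A \<in> U \<and> i \<in> s A. f A) = (\<Sum>A | A \<in> U \<and> I \<subseteq> s A. f A)"
    using i \<open>finite U\<close> by (intro sum.mono_neutral_right) (auto simp: T_def)
  then show ?thesis using i by blast
qed

text \<open>The coordinates determine the mass above each element, being least coordinates over the
  corresponding index set. Descending induction from the maximal elements then recovers the single
  weights.\<close>

lemma chain_points_eqI:
  fixes f g :: "'x::order \<Rightarrow> real" and s :: "'x \<Rightarrow> nat set"
  assumes f: "f \<in> chain_points U (\<le>)" and g: "g \<in> chain_points U (\<le>)" and "finite U"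
    and mono: "\<And>A B. A \<in> U \<Longrightarrow> B \<in> U \<Longrightarrow> A \<le> B \<longleftrightarrow> s A \<subseteq> s B"
    and s: "\<And>A. A \<in> U \<Longrightarrow> s A \<noteq> {} \<and> s A \<subseteq> N"
    and eq: "\<And>i. i \<in> N \<Longrightarrow> (\<Sum>A | A \<in> U \<and> i \<in> s A. f A) = (\<Sum>A | A \<in> U \<and> i \<in> s A. g A)"
  shows "f = g"
proof -
  have le: "(\<Sum>A | A \<in> U \<and> s B \<subseteq> s A. v A) \<le> (\<Sum>A | A \<in> U \<and> s B \<subseteq> s A. u A)"
    if u: "u \<in> chain_points U (\<le>)" and v: "v \<in> chain_points U (\<le>)" and B: "B \<in> U"
      and uv: "\<And>i. i \<in> N \<Longrightarrow> (\<Sum>A | A \<in> U \<and> i \<in> s A. u A) = (\<Sum>A | A \<in> U \<and> i \<in> s A. v A)" for u v B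
  proof -
    obtain i where i: "i \<in> s B" "(\<Sum>A | A \<in> U \<and> i \<in> s A. u A) = (\<Sum>A | A \<in> U \<and> s B \<subseteq> s A. u A)"
      using superset_sum_attained[OF u \<open>finite U\<close>, of s "s B"] mono s[OF B] by blast
    have "(\<Sum>A | A \<in> U \<and> s B \<subseteq> s A. v A) \<le> (\<Sum>A | A \<in> U \<and> i \<in> s A. v A)"
      using i(1) \<open>finite U\<close> chain_pointsD(1)[OF v] by (intro sum_mono2) auto
    also have "\<dots> = (\<Sum>A | A \<in> U \<and> i \<in> s A. u A)" using uv i(1) s[OF B] by auto
    finally show ?thesis using i(2) by simp
  qed
  have sums: "(\<Sum>A | A \<in> U \<and> B \<le> A. f A) = (\<Sum>A | A \<in> U \<and> B \<le> A. g A)" if "B \<in> U" for B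
  proof -
    have "{A \<in> U. B \<le> A} = {A \<in> U. s B \<subseteq> s A}" using mono that by auto
    then show ?thesis using le[OF f g that eq] le[OF g f that eq[symmetric]] by simp
  qed
  have "f B = g B" if "B \<in> U" for B
    using that
  proof (induction "card {A \<in> U. B < A}" arbitrary: B rule: less_induct)
    case less
    have "f A = g A" if "A \<in> U" "B < A" for A
    proof (rule less.hyps[OF _ that(1)])
      have "{C \<in> U. A < C} \<subset> {C \<in> U. B < C}" using that by auto
      then show "card {C \<in> U. A < C} < card {C \<in> U. B < C}"
        using \<open>finite U\<close> by (intro psubset_card_mono) auto
    qed
    then have above: "(\<Sum>A | A \<in> U \<and> B < A. f A) = (\<Sum>A | A \<in> U \<and> B < A. g A)" by simp
    have "{A \<in> U. B \<le> A} = insert B {A \<in> U. B < A}" using less.prems by auto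
    then have "(\<Sum>A | A \<in> U \<and> B \<le> A. h A) = h B + (\<Sum>A | A \<in> U \<and> B < A. h A)" for h :: "'x \<Rightarrow> real"
      using \<open>finite U\<close> by simp
    then show ?case using sums[OF less.prems] above by simp
  qed
  moreover have "f B = g B" if "B \<notin> U" for B
    using that chain_pointsD(2)[OF f, of B] chain_pointsD(2)[OF g, of B] by metis
  ultimately show ?thesis by blast
qed

text \<open>The weight of a superlevel set is the length of the set of levels at which it occurs.\<close>

lemma layer_cake:
  fixes v :: "nat \<Rightarrow> real" and s :: "'x::order \<Rightarrow> nat set"
  assumes bij: "bij_betw s U (Pow N - {{}, N})" and N: "finite N" and "finite U"
    and mono: "\<And>A B. A \<in> U \<Longrightarrow> B \<in> U \<Longrightarrow> A \<le> B \<longleftrightarrow> s A \<subseteq> s B"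
    and v: "\<And>i. i \<in> N \<Longrightarrow> 0 \<le> v i \<and> v i \<le> 1" and lo: "lo \<in> N" "v lo = 0" and hi: "hi \<in> N" "v hi = 1"
  obtains f where "f \<in> chain_points U (\<le>)" "\<And>i. i \<in> N \<Longrightarrow> (\<Sum>A | A \<in> U \<and> i \<in> s A. f A) = v i"
proof -
  define L where "L t = {i \<in> N. t \<le> v i}" for t
  \<comment> \<open>Level 0 is left out because its superlevel set is all of \<open>N\<close>. At
    levels in (0, 1] the set contains \<open>hi\<close> but not \<open>lo\<close>, so it is one of
    the sets \<open>s A\<close>.\<close>
  define S where "S A = {t \<in> {0<..1}. L t = s A}" for A
  define f where "f A = (if A \<in> U then measure lborel (S A) else 0)" for A
  have s_N: "s A \<subseteq> N" if "A \<in> U" for A using bij that unfolding bij_betw_def by blast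
  have L_iff: "L t = s A \<longleftrightarrow> (\<forall>i\<in>N. i \<in> s A \<longleftrightarrow> t \<le> v i)" if "A \<in> U" for A t
    using s_N[OF that] unfolding L_def by blast
  have sets: "S A \<in> sets lborel" if "A \<in> U" for A
  proof -
    have "{t. i \<in> s A \<longleftrightarrow> t \<le> v i} = (if i \<in> s A then {..v i} else {v i<..})" for i by auto
    then have "{t. i \<in> s A \<longleftrightarrow> t \<le> v i} \<in> sets lborel" for i by simp
    then have "(\<Inter>i\<in>N. {t. i \<in> s A \<longleftrightarrow> t \<le> v i}) \<in> sets lborel"
      using N lo by (intro sets.finite_INT) auto
    then have "{0<..1} \<inter> (\<Inter>i\<in>N. {t. i \<in> s A \<longleftrightarrow> t \<le> v i}) \<in> sets lborel" by (intro sets.Int) auto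
    also have "{0<..1} \<inter> (\<Inter>i\<in>N. {t. i \<in> s A \<longleftrightarrow> t \<le> v i}) = S A"
      unfolding S_def L_iff[OF that] by auto
    finally show ?thesis .
  qed
  have L_U: "\<exists>A\<in>U. L t = s A" if "t \<in> {0<..1}" for t
  proof -
    have "hi \<in> L t" "lo \<notin> L t" "L t \<subseteq> N" using that lo hi unfolding L_def by auto
    then have "L t \<in> Pow N - {{}, N}" using lo(1) by auto
    then have "L t \<in> s ` U" using bij_betw_imp_surj_on[OF bij] by simp
    then show ?thesis by blast
  qed
  have sum_f: "sum f V = measure lborel {t \<in> {0<..1}. \<exists>A\<in>V. L t = s A}" if "V \<subseteq> U" for V
  proof -
    have "finite V" using that \<open>finite U\<close> finite_subset by blast
    have "sum f V = (\<Sum>A\<in>V. measure lborel (S A))" using that by (intro sum.cong) (auto simp: f_def)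
    also have "\<dots> = measure lborel (\<Union>A\<in>V. S A)"
    proof (rule measure_finite_Union[symmetric, OF \<open>finite V\<close>])
      show "disjoint_family_on S V"
        unfolding disjoint_family_on_def
      proof (intro ballI impI)
        fix A B assume "A \<in> V" "B \<in> V" "A \<noteq> B"
        then have "s A \<noteq> s B"
          using inj_onD[OF bij_betw_imp_inj_on[OF bij], of A B] \<open>V \<subseteq> U\<close> by auto
        then show "S A \<inter> S B = {}" by (auto simp: S_def)
      qed
      show "emeasure lborel (S A) \<noteq> \<infinity>" for A
      proof -
        have "emeasure lborel (S A) \<le> emeasure lborel {0<..1::real}"
          by (intro emeasure_mono) (auto simp: S_def)
        then show ?thesis by (auto simp: top_unique)
      qed
    qed (use sets that in auto)
    also have "(\<Union>A\<in>V. S A) = {t \<in> {0<..1}. \<exists>A\<in>V. L t = s A}" by (auto simp: S_def)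
    finally show ?thesis .
  qed
  have "f \<in> chain_points U (\<le>)"
  proof (rule chain_pointsI)
    have "{t \<in> {0<..1}. \<exists>A\<in>U. L t = s A} = {0<..1::real}" using L_U by auto
    then show "sum f U = 1" using sum_f[of U] by simp
    show "A \<le> B \<or> B \<le> A" if "f A \<noteq> 0" "f B \<noteq> 0" for A B
    proof -
      have U: "A \<in> U" "B \<in> U" using that by (auto simp: f_def split: if_splits)
      have "S A \<noteq> {}" "S B \<noteq> {}" using that by (auto simp: f_def split: if_splits)
      then obtain t r where "L t = s A" "L r = s B" by (auto simp: S_def)
      moreover have "L t \<subseteq> L r \<or> L r \<subseteq> L t" unfolding L_def by force
      ultimately show ?thesis using mono U by auto
    qed
  qed (auto simp: f_def split: if_splits)
  moreover have "(\<Sum>A | A \<in> U \<and> i \<in> s A. f A) = v i" if "i \<in> N" for i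
  proof -
    have "{t \<in> {0<..1}. \<exists>A\<in>{A \<in> U. i \<in> s A}. L t = s A} = {t \<in> {0<..1}. i \<in> L t}"
      using L_U by auto
    also have "\<dots> = {0<..v i}" using v[OF that] that by (auto simp: L_def)
    finally show ?thesis using sum_f[of "{A \<in> U. i \<in> s A}"] v[OF that] by simp
  qed
  ultimately show thesis using that by blast
qed

text \<open>A coordinate outside the largest support set is 0, and a coordinate inside the smallest
  one collects the whole mass 1.\<close>

lemma coordinate_sum_extrema:
  fixes f :: "'x::order \<Rightarrow> real" and s :: "'x \<Rightarrow> nat set"
  assumes f: "f \<in> chain_points U (\<le>)" and "finite U"
    and mono: "\<And>A B. A \<in> U \<Longrightarrow> B \<in> U \<Longrightarrow> A \<le> B \<Longrightarrow> s A \<subseteq> s B"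
    and s: "\<And>A. A \<in> U \<Longrightarrow> s A \<noteq> {} \<and> s A \<subset> N"
  defines "v \<equiv> \<lambda>i. \<Sum>A | A \<in> U \<and> i \<in> s A. f A"
  shows "0 \<le> v i" "v i \<le> 1" "\<exists>i\<in>N. v i = 0" "\<exists>i\<in>N. v i = 1"
proof -
  note nonneg = chain_pointsD(1)[OF f]
  show "0 \<le> v i" unfolding v_def by (intro sum_nonneg nonneg)
  have "v i \<le> sum f U" unfolding v_def using \<open>finite U\<close> by (intro sum_mono2) (auto intro: nonneg)
  then show "v i \<le> 1" using chain_pointsD(3)[OF f] by simp
  define T where "T = {A \<in> U. f A \<noteq> 0}"
  have T: "finite T" using \<open>finite U\<close> by (simp add: T_def)
  have T_ne: "T \<noteq> {}"
  proof
    assume "T = {}"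
    then have "sum f U = 0" by (auto simp: T_def intro: sum.neutral)
    then show False using chain_pointsD(3)[OF f] by simp
  qed
  have chain: "A \<le> B \<or> B \<le> A" if "A \<in> T" "B \<in> T" for A B
    using chain_pointsD(4)[OF f, of A B] that by (auto simp: T_def)
  have v_T: "v i = (\<Sum>A | A \<in> T \<and> i \<in> s A. f A)" for i
    unfolding v_def T_def using \<open>finite U\<close> by (intro sum.mono_neutral_right) auto
  obtain M where M: "M \<in> T" "\<And>A. A \<in> T \<Longrightarrow> M \<le> A \<Longrightarrow> M = A"
    using finite_has_maximal[OF T T_ne] by metis
  obtain i where i: "i \<in> N" "i \<notin> s M" using s[of M] M(1) by (auto simp: T_def)
  have "s A \<subseteq> s M" if "A \<in> T" for A
    using chain[OF that M(1)] M(2)[OF that] mono[of A M] that M(1) by (auto simp: T_def)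
  then have "{A \<in> T. i \<in> s A} = {}" using i by blast
  then show "\<exists>i\<in>N. v i = 0" using i(1) v_T[of i] by (metis sum.empty)
  obtain m where m: "m \<in> T" "\<And>A. A \<in> T \<Longrightarrow> A \<le> m \<Longrightarrow> m = A"
    using finite_has_minimal[OF T T_ne] by metis
  obtain j where j: "j \<in> s m" using s[of m] m(1) by (auto simp: T_def)
  have "s m \<subseteq> s A" if "A \<in> T" for A
    using chain[OF that m(1)] m(2)[OF that] mono[of m A] that m(1) by (auto simp: T_def)
  then have "{A \<in> T. j \<in> s A} = T" using j by blast
  moreover have "sum f T = sum f U"
    unfolding T_def using \<open>finite U\<close> by (intro sum.mono_neutral_left) auto
  ultimately have "v j = 1" using v_T[of j] chain_pointsD(3)[OF f] by simp
  moreover have "j \<in> N" using s[of m] m(1) j by (auto simp: T_def)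
  ultimately show "\<exists>i\<in>N. v i = 1" by blast
qed

text \<open>Both vectors have spread exactly 1, so the scaling factors agree; both have minimum 0,
  so the translations agree too.\<close>

lemma normalised_vectors_eq:
  fixes v w :: "'i \<Rightarrow> real"
  assumes v: "\<And>i. i \<in> N \<Longrightarrow> 0 \<le> v i \<and> v i \<le> 1" "\<exists>i\<in>N. v i = 0" "\<exists>i\<in>N. v i = 1"
    and w: "\<And>i. i \<in> N \<Longrightarrow> 0 \<le> w i \<and> w i \<le> 1" "\<exists>i\<in>N. w i = 0" "\<exists>i\<in>N. w i = 1"
    and a: "0 < a" and b: "0 < b"
    and eq: "\<And>i. i \<in> N \<Longrightarrow> (v i - k) / a = (w i - l) / b" and "i \<in> N"
  shows "v i = w i"
proof -
  obtain i0 i1 j0 j1 where i: "i0 \<in> N" "v i0 = 0" "i1 \<in> N" "v i1 = 1"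
    and j: "j0 \<in> N" "w j0 = 0" "j1 \<in> N" "w j1 = 1" using v w by blast
  have eq': "b * (v i - k) = a * (w i - l)" if "i \<in> N" for i
    using eq[OF that] a b by (simp add: field_simps)
  have "b = a * (w i1 - w i0)" using eq'[OF i(1)] eq'[OF i(3)] i by (simp add: algebra_simps)
  also have "\<dots> \<le> a * 1" using w(1)[OF i(1)] w(1)[OF i(3)] a by (intro mult_left_mono) auto
  finally have "b \<le> a" by simp
  have "a = b * (v j1 - v j0)" using eq'[OF j(1)] eq'[OF j(3)] j by (simp add: algebra_simps)
  also have "\<dots> \<le> b * 1" using v(1)[OF j(1)] v(1)[OF j(3)] b by (intro mult_left_mono) auto
  finally have "a = b" using \<open>b \<le> a\<close> by simp
  then have sub: "v i - k = w i - l" if "i \<in> N" for i using eq'[OF that] a by simp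
  have "k = l" using sub[OF i(1)] sub[OF j(1)] i(2) j(2) w(1)[OF i(1)] v(1)[OF j(1)] by linarith
  then show ?thesis using sub[OF \<open>i \<in> N\<close>] by simp
qed

text \<open>The coordinates \<open>v f\<close> are the vectors with m+2 entries, minimum 0 and
  maximum 1: one from each class of nonconstant vectors modulo constants and positive scaling.
  Subtracting the last entry and dividing by the norm picks the representative on the unit sphere
  instead.\<close>

lemma Boolean_lattice_homeomorphic_nsphere:
  fixes U :: "'x::order set" and s :: "'x \<Rightarrow> nat set"
  assumes bij: "bij_betw s U (Pow {..Suc m} - {{}, {..Suc m}})"
    and mono: "\<And>A B. A \<in> U \<Longrightarrow> B \<in> U \<Longrightarrow> A \<le> B \<longleftrightarrow> s A \<subseteq> s B"
  shows "top_of_set (chain_points U (\<le>)) homeomorphic_space nsphere m"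
proof -
  let ?N = "{..Suc m}"
  have finU: "finite U" using bij bij_betw_finite by auto
  have s_N: "s A \<noteq> {} \<and> s A \<subset> ?N" if "A \<in> U" for A using bij that unfolding bij_betw_def by blast
  define v where "v f i = (\<Sum>A | A \<in> U \<and> i \<in> s A. f A)" for f :: "'x \<Rightarrow> real" and i
  define d where "d f i = v f i - v f (Suc m)" for f i
  define D where "D f = sqrt (\<Sum>i\<le>m. (d f i)\<^sup>2)" for f
  define \<theta> where "\<theta> f i = (if i \<le> m then d f i / D f else 0)" for f i
  have mono': "s A \<subseteq> s B" if "A \<in> U" "B \<in> U" "A \<le> B" for A B using mono that by blast
  have ext: "0 \<le> v f i \<and> v f i \<le> 1" "\<exists>i\<in>?N. v f i = 0" "\<exists>i\<in>?N. v f i = 1"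
    if "f \<in> chain_points U (\<le>)" for f i
    using coordinate_sum_extrema[where s = s, OF that finU mono' s_N] unfolding v_def by auto
  have D_pos: "D f > 0" if f: "f \<in> chain_points U (\<le>)" for f
  proof -
    obtain i j where ij: "i \<le> Suc m" "v f i = 0" "j \<le> Suc m" "v f j = 1" using ext[OF f] by auto
    \<comment> \<open>Whatever the last entry is, it differs from one of the entries 0 and
      1.\<close>
    then have "\<exists>i\<le>m. d f i \<noteq> 0"
      by (cases "v f (Suc m) = 0") (auto simp: d_def le_Suc_eq)
    then have "(\<Sum>i\<le>m. (d f i)\<^sup>2) > 0" by (auto intro: sum_pos2)
    then show ?thesis by (simp add: D_def)
  qed
  have \<theta>_in: "\<theta> f \<in> topspace (nsphere m)" if f: "f \<in> chain_points U (\<le>)" for f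
  proof -
    have "(\<Sum>i\<le>m. (\<theta> f i)\<^sup>2) = (\<Sum>i\<le>m. (d f i)\<^sup>2) / (D f)\<^sup>2"
      by (simp add: \<theta>_def power_divide sum_divide_distrib)
    also have "(\<Sum>i\<le>m. (d f i)\<^sup>2) = (D f)\<^sup>2" unfolding D_def by (simp add: sum_nonneg)
    finally show ?thesis using D_pos[OF f] by (simp add: nsphere \<theta>_def)
  qed
  have cv: "continuous_on S (\<lambda>f. v f i)" for S i
    unfolding v_def by (intro continuous_on_sum continuous_on_eval)
  have "continuous_on (chain_points U (\<le>)) \<theta>"
  proof (rule continuous_on_coordinatewise_then_product)
    show "continuous_on (chain_points U (\<le>)) (\<lambda>f. \<theta> f i)" for i
      using D_pos unfolding \<theta>_def d_def D_def
      by (cases "i \<le> m") (auto intro!: continuous_intros cv simp: less_imp_neq[symmetric] d_def D_def)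
  qed
  then have "continuous_map (top_of_set (chain_points U (\<le>))) (nsphere m) \<theta>"
    using \<theta>_in by (auto simp: nsphere euclidean_product_topology continuous_map_in_subtopology)
  moreover have "\<theta> ` topspace (top_of_set (chain_points U (\<le>))) = topspace (nsphere m)"
  proof (intro equalityI subsetI)
    fix x assume "x \<in> topspace (nsphere m)"
    then have x: "(\<Sum>i\<le>m. (x i)\<^sup>2) = 1" "\<And>i. i > m \<Longrightarrow> x i = 0" by (auto simp: nsphere)
    \<comment> \<open>\<open>x\<close> vanishes at \<open>Suc m\<close>, so all m+2 entries are
      available; rescaling their minimum to 0 and maximum to 1 gives the coordinates of the
      preimage. If \<open>a = b\<close>, every entry would be 0.\<close>
    define a where "a = Min (x ` ?N)"
    define b where "b = Max (x ` ?N)"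
    have ab: "a \<le> x i" "x i \<le> b" if "i \<in> ?N" for i using that by (auto simp: a_def b_def)
    have a_in: "a \<in> x ` ?N" unfolding a_def by (intro Min_in) auto
    have b_in: "b \<in> x ` ?N" unfolding b_def by (intro Max_in) auto
    obtain i j where ij: "i \<in> ?N" "x i = a" "j \<in> ?N" "x j = b" using a_in b_in by blast
    have "a < b"
    proof (rule ccontr)
      assume "\<not> a < b"
      then have "x i = x (Suc m)" if "i \<le> m" for i
        using ab[of i] ab[of "Suc m"] that by auto
      then have "(\<Sum>i\<le>m. (x i)\<^sup>2) = 0" using x(2)[of "Suc m"] by simp
      then show False using x(1) by simp
    qed
    obtain f where f: "f \<in> chain_points U (\<le>)" "\<And>i. i \<in> ?N \<Longrightarrow> v f i = (x i - a) / (b - a)"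
    proof (rule layer_cake[OF bij _ finU mono, of "\<lambda>i. (x i - a) / (b - a)" i j])
      show "0 \<le> (x i - a) / (b - a) \<and> (x i - a) / (b - a) \<le> 1" if "i \<in> ?N" for i
        using ab[OF that] \<open>a < b\<close> by simp
    qed (use ij \<open>a < b\<close> in \<open>auto simp: v_def\<close>)
    have d: "d f i = x i / (b - a)" if "i \<le> m" for i
      using f(2)[of i] f(2)[of "Suc m"] that x(2)[of "Suc m"]
      by (simp add: d_def diff_divide_distrib)
    have "D f = sqrt ((\<Sum>i\<le>m. (x i)\<^sup>2) / (b - a)\<^sup>2)"
      unfolding D_def using d by (simp add: power_divide sum_divide_distrib)
    then have "D f = 1 / (b - a)" using x(1) \<open>a < b\<close> by (simp add: real_sqrt_divide)
    then have "\<theta> f = x" using d x(2) \<open>a < b\<close> by (auto simp: \<theta>_def fun_eq_iff)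
    then show "x \<in> \<theta> ` topspace (top_of_set (chain_points U (\<le>)))" using f(1) by force
  qed (use \<theta>_in in auto)
  moreover have "inj_on \<theta> (topspace (top_of_set (chain_points U (\<le>))))"
  proof (rule inj_onI)
    fix f g assume "f \<in> topspace (top_of_set (chain_points U (\<le>)))"
      "g \<in> topspace (top_of_set (chain_points U (\<le>)))" and eq: "\<theta> f = \<theta> g"
    then have f: "f \<in> chain_points U (\<le>)" and g: "g \<in> chain_points U (\<le>)" by auto
    have "d f i / D f = d g i / D g" if "i \<in> ?N" for i
      using fun_cong[OF eq, of i] that by (cases "i = Suc m") (auto simp: \<theta>_def d_def)
    then have "v f i = v g i" if "i \<in> ?N" for i
      using normalised_vectors_eq[OF ext[OF f] ext[OF g] D_pos[OF f] D_pos[OF g] _ that] 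
      unfolding d_def by blast
    then show "f = g"
      using s_N by (intro chain_points_eqI[OF f g finU mono, of ?N]) (auto simp: v_def)
  qed
  moreover have "Hausdorff_space (nsphere m)"
    unfolding nsphere euclidean_product_topology by (rule Hausdorff_space_function)
  ultimately have "homeomorphic_map (top_of_set (chain_points U (\<le>))) (nsphere m) \<theta>"
    by (intro continuous_imp_homeomorphic_map compact_space_chain_points finU)
  then show ?thesis by (rule homeomorphic_map_imp_homeomorphic_space)
qed

subsection \<open>Conjugation racks in a group\<close>

context group
begin

definition conj_by :: "'a \<Rightarrow> 'a \<Rightarrow> 'a" where
  "conj_by g x = g \<otimes> x \<otimes> inv g"

lemma conj_by_closed [simp]: "g \<in> carrier G \<Longrightarrow> x \<in> carrier G \<Longrightarrow> conj_by g x \<in> carrier G"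
  by (simp add: conj_by_def)

lemma conj_by_one [simp]: "x \<in> carrier G \<Longrightarrow> conj_by \<one> x = x"
  by (simp add: conj_by_def)

lemma conj_by_mult:
  "g \<in> carrier G \<Longrightarrow> h \<in> carrier G \<Longrightarrow> x \<in> carrier G \<Longrightarrow> conj_by (g \<otimes> h) x = conj_by g (conj_by h x)"
  by (simp add: conj_by_def inv_mult_group m_assoc)

lemma conj_by_inv [simp]:
  "g \<in> carrier G \<Longrightarrow> x \<in> carrier G \<Longrightarrow> conj_by (inv g) (conj_by g x) = x"
  "g \<in> carrier G \<Longrightarrow> x \<in> carrier G \<Longrightarrow> conj_by g (conj_by (inv g) x) = x"
  by (simp_all add: conj_by_mult[symmetric])

lemma conj_by_hom:
  assumes "g \<in> carrier G" "x \<in> carrier G" "y \<in> carrier G"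
  shows "conj_by g (x \<otimes> y) = conj_by g x \<otimes> conj_by g y"
proof -
  have "inv g \<otimes> (g \<otimes> z) = z" if "z \<in> carrier G" for z
    using assms that by (simp add: m_assoc[symmetric])
  then show ?thesis using assms by (simp add: conj_by_def m_assoc)
qed

lemma conj_by_conj_by:
  assumes "g \<in> carrier G" "a \<in> carrier G" "b \<in> carrier G"
  shows "conj_by g (conj_by a b) = conj_by (conj_by g a) (conj_by g b)"
proof -
  have "conj_by (conj_by g a) (conj_by g b) = conj_by (g \<otimes> a \<otimes> inv g \<otimes> g) b"
    using assms by (simp add: conj_by_mult conj_by_def[of g a])
  also have "g \<otimes> a \<otimes> inv g \<otimes> g = g \<otimes> a" using assms by (simp add: m_assoc)
  finally show ?thesis using assms by (simp add: conj_by_mult)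
qed

lemma conj_by_pow:
  "g \<in> carrier G \<Longrightarrow> x \<in> carrier G \<Longrightarrow> conj_by g x [^] (n::nat) = conj_by g (x [^] n)"
  by (induction n) (simp_all add: conj_by_hom, simp add: conj_by_def)

lemma conj_by_eq_one_iff:
  assumes "g \<in> carrier G" "x \<in> carrier G" shows "conj_by g x = \<one> \<longleftrightarrow> x = \<one>"
proof
  assume "conj_by g x = \<one>"
  then have "conj_by (inv g) \<one> = x" using conj_by_inv(1)[OF assms] by simp
  then show "x = \<one>" using assms by (simp add: conj_by_def)
qed (use assms in \<open>simp add: conj_by_def\<close>)

lemma ord_conj_by: "g \<in> carrier G \<Longrightarrow> x \<in> carrier G \<Longrightarrow> ord (conj_by g x) = ord x"
  by (subst ord_unique) (simp_all add: conj_by_pow conj_by_eq_one_iff pow_eq_id)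

lemma subracks_iff: "S \<in> subracks X \<longleftrightarrow> S \<subseteq> X \<and> (\<forall>a\<in>S. \<forall>b\<in>S. conj_by a b \<in> S)"
  unfolding subracks_def conj_by_def by simp

lemma subracks_Int: "S \<in> subracks X \<Longrightarrow> T \<in> subracks X \<Longrightarrow> S \<inter> T \<in> subracks X"
  unfolding subracks_def by blast

lemma subracks_Inter: "M \<subseteq> subracks X \<Longrightarrow> M \<noteq> {} \<Longrightarrow> \<Inter>M \<in> subracks X"
  unfolding subracks_def by blast

text \<open>Cauchy's theorem: with exponent 1, Sylow's theorem yields a subgroup of order
  \<open>p\<close>.\<close>

lemma ex_ord_eq_prime:
  assumes "finite (carrier G)" "prime p" "p dvd order G"
  shows "\<exists>x\<in>carrier G. ord x = p"
proof -
  obtain K where K: "subgroup K G" "card K = p"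
    using sylow_thm[of p G 1 "order G div p"] assms is_group by auto
  have "1 < card K" using K(2) prime_gt_1_nat[OF assms(2)] by simp
  then have "\<not> K \<subseteq> {\<one>}" using card_mono[of "{\<one>}" K] by auto
  then obtain x where x: "x \<in> K" "x \<noteq> \<one>" by blast
  then have xG: "x \<in> carrier G" using subgroup.subset[OF K(1)] by auto
  interpret K: group "G\<lparr>carrier := K\<rparr>" by (rule subgroup.subgroup_is_group[OF K(1) is_group])
  have "x [^] p = \<one>"
    using K.pow_order_eq_1[of x] x(1) K(2) nat_pow_consistent[of x p K] by (simp add: order_def)
  then have "ord x dvd p" using pow_eq_id[OF xG] by simp
  moreover have "ord x \<noteq> 1" using ord_eq_1[OF xG] x(2) by simp
  ultimately show ?thesis using assms(2) xG prime_nat_iff by blast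
qed

end

text \<open>Closure under inverses lets the inverses of generators of \<open>H\<close> also act
  through elements of \<open>X\<close>.\<close>

locale conjugation_rack = group G for G (structure) +
  fixes X :: "'a set"
  assumes X_carrier: "X \<subseteq> carrier G" and finite_X: "finite X"
    and conj_X: "a \<in> X \<Longrightarrow> b \<in> X \<Longrightarrow> conj_by a b \<in> X"
    and inv_X: "a \<in> X \<Longrightarrow> inv a \<in> X"
begin

abbreviation H :: "'a set" where "H \<equiv> generate G X"

lemma X_in [simp]: "x \<in> X \<Longrightarrow> x \<in> carrier G"
  using X_carrier by auto

lemma H_subgroup: "subgroup H G"
  using generate_is_subgroup[OF X_carrier] .

lemma H_in [simp]: "h \<in> H \<Longrightarrow> h \<in> carrier G"
  using subgroup.subset[OF H_subgroup] by auto

lemma H_inv [simp]: "h \<in> H \<Longrightarrow> inv h \<in> H"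
  using subgroup.m_inv_closed[OF H_subgroup] .

lemma H_one [simp]: "\<one> \<in> H" by (rule generate.one)

lemma stable_under_H:
  assumes "S \<subseteq> X" "\<And>a s. a \<in> X \<Longrightarrow> s \<in> S \<Longrightarrow> conj_by a s \<in> S" "h \<in> H" "s \<in> S"
  shows "conj_by h s \<in> S"
  using \<open>h \<in> H\<close> \<open>s \<in> S\<close>
proof (induction arbitrary: s rule: generate.induct)
  case (eng h1 h2)
  then show ?case using assms(1) by (subst conj_by_mult) auto
qed (use assms inv_X in auto)

lemma conj_H_X: "h \<in> H \<Longrightarrow> x \<in> X \<Longrightarrow> conj_by h x \<in> X"
  using stable_under_H[of X] conj_X by blast

section \<open>Classes, unions of classes, and saturation\<close>

definition orbit :: "'a \<Rightarrow> 'a set" where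
  "orbit x = (\<lambda>h. conj_by h x) ` H"

lemma orbit_self: "x \<in> X \<Longrightarrow> x \<in> orbit x"
  unfolding orbit_def by (rule image_eqI[of _ _ \<one>]) auto

lemma orbit_subset: "x \<in> X \<Longrightarrow> orbit x \<subseteq> X"
  unfolding orbit_def using conj_H_X by auto

lemma orbit_conj:
  assumes "h \<in> H" "x \<in> X" shows "orbit (conj_by h x) = orbit x"
proof -
  have sub: "orbit (conj_by h x) \<subseteq> orbit x" if "h \<in> H" "x \<in> X" for h x
  proof
    fix y assume "y \<in> orbit (conj_by h x)"
    then obtain k where k: "k \<in> H" "y = conj_by k (conj_by h x)" unfolding orbit_def by auto
    then have "y = conj_by (k \<otimes> h) x" using that by (simp add: conj_by_mult)
    then show "y \<in> orbit x" unfolding orbit_def using k that generate.eng[of k G X h] by auto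
  qed
  have "orbit x = orbit (conj_by (inv h) (conj_by h x))" using assms by simp
  also have "\<dots> \<subseteq> orbit (conj_by h x)" using assms by (intro sub conj_H_X) auto
  finally show ?thesis using sub[OF assms] by blast
qed

lemma orbit_eq:
  assumes "x \<in> X" "y \<in> orbit x" shows "orbit y = orbit x"
proof -
  obtain h where "h \<in> H" "y = conj_by h x" using assms(2) unfolding orbit_def by auto
  then show ?thesis using orbit_conj assms(1) by simp
qed

text \<open>A class contains its representative, so a class inside \<open>X\<close> is represented
  in \<open>X\<close>; conversely \<open>X\<close> lies in \<open>H\<close> and is invariant under
  it.\<close>

lemma conj_classes_eq: "conj_classes_in H X = orbit ` X"
proof -
  have orb: "{h \<otimes> x \<otimes> inv h |h. h \<in> H} = orbit x" for x
    unfolding orbit_def conj_by_def by auto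
  have "x \<in> X" if "x \<in> H" "orbit x \<subseteq> X" for x
  proof -
    have "conj_by \<one> x \<in> orbit x" unfolding orbit_def using H_one by blast
    then show ?thesis using that by auto
  qed
  moreover have "x \<in> H" if "x \<in> X" for x using that by (rule generate.incl)
  ultimately show ?thesis unfolding conj_classes_in_def orb using orbit_subset by auto
qed

text \<open>The unions of classes, with \<open>{}\<close> and \<open>X\<close> included.\<close>

definition stable :: "'a set set" where
  "stable = {S. S \<subseteq> X \<and> (\<forall>h\<in>H. \<forall>s\<in>S. conj_by h s \<in> S)}"

lemma stable_orbit: "S \<in> stable \<Longrightarrow> s \<in> S \<Longrightarrow> orbit s \<subseteq> S"
  unfolding stable_def orbit_def by auto

lemma stable_subrack: "S \<in> stable \<Longrightarrow> S \<in> subracks X"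
  unfolding stable_def subracks_iff by (auto intro: generate.incl)

lemma X_stable: "X \<in> stable"
  unfolding stable_def using conj_H_X by auto

definition saturation :: "'a set \<Rightarrow> 'a set" where
  "saturation A = {x \<in> X. orbit x \<inter> A \<noteq> {}}"

lemma saturation_stable: "saturation A \<in> stable"
  unfolding saturation_def stable_def using conj_H_X orbit_conj by auto

lemma saturation_ge: "A \<subseteq> X \<Longrightarrow> A \<subseteq> saturation A"
  unfolding saturation_def using orbit_self by auto

lemma saturation_mono: "A \<subseteq> B \<Longrightarrow> saturation A \<subseteq> saturation B"
  unfolding saturation_def by auto

lemma saturation_id: "S \<in> stable \<Longrightarrow> saturation S = S"
proof
  assume S: "S \<in> stable"
  show "saturation S \<subseteq> S"
  proof
    fix x assume "x \<in> saturation S"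
    then obtain y where y: "x \<in> X" "y \<in> orbit x" "y \<in> S" unfolding saturation_def by auto
    then have "x \<in> orbit y" using orbit_eq[OF y(1,2)] orbit_self[OF y(1)] by simp
    then show "x \<in> S" using stable_orbit[OF S y(3)] by auto
  qed
qed (use saturation_ge in \<open>auto simp: stable_def\<close>)

lemma saturation_X: "saturation X = X"
  by (rule saturation_id[OF X_stable])

text \<open>\<open>A\<close> meets every class, and it meets a class contained in \<open>S\<close>
  inside \<open>S\<close>. This is the source of \<open>f_meet\<close>.\<close>

lemma saturation_Int_stable:
  assumes "S \<in> stable" "saturation A = X" shows "saturation (S \<inter> A) = S"
proof
  show "saturation (S \<inter> A) \<subseteq> S"
    using saturation_mono[of "S \<inter> A" S] saturation_id[OF assms(1)] by auto
  show "S \<subseteq> saturation (S \<inter> A)"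
  proof
    fix x assume x: "x \<in> S"
    then have "x \<in> saturation A" using assms by (auto simp: stable_def)
    then show "x \<in> saturation (S \<inter> A)"
      using stable_orbit[OF assms(1) x] unfolding saturation_def by auto
  qed
qed

subsubsection \<open>Maximal subracks\<close>

lemma finite_subracks: "finite (subracks X)"
  by (rule finite_subset[of _ "Pow X"]) (auto simp: subracks_def finite_X)

lemma ex_maximal_subrack:
  assumes "A \<in> subracks X" "A \<noteq> X" shows "\<exists>N\<in>maximal_subracks X. A \<subseteq> N"
proof -
  have "finite (subracks X - {X})" using finite_subracks by auto
  then obtain N where "N \<in> subracks X - {X}" "A \<subseteq> N" "\<forall>T\<in>subracks X - {X}. N \<subseteq> T \<longrightarrow> N = T"
    using finite_has_maximal2[of "subracks X - {X}" A] assms by blast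
  then show ?thesis unfolding maximal_subracks_def by (intro bexI[of _ N]) auto
qed

lemma subrack_conj:
  assumes "h \<in> H" "A \<in> subracks X" shows "conj_by h ` A \<in> subracks X"
proof -
  have A: "A \<subseteq> X" "\<And>a b. a \<in> A \<Longrightarrow> b \<in> A \<Longrightarrow> conj_by a b \<in> A"
    using assms(2) unfolding subracks_iff by auto
  have "conj_by (conj_by h a) (conj_by h b) \<in> conj_by h ` A" if "a \<in> A" "b \<in> A" for a b
  proof -
    have "h \<in> carrier G" "a \<in> carrier G" "b \<in> carrier G" using A(1) that assms(1) by auto
    then have "conj_by (conj_by h a) (conj_by h b) = conj_by h (conj_by a b)"
      by (rule conj_by_conj_by[symmetric])
    then show ?thesis using A(2)[OF that] by simp
  qed
  then show ?thesis unfolding subracks_iff using A(1) conj_H_X[OF assms(1)] by auto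
qed

lemma conj_image_inv:
  assumes "h \<in> H" "A \<subseteq> X"
  shows "conj_by (inv h) ` conj_by h ` A = A" "conj_by h ` conj_by (inv h) ` A = A"
proof -
  have "conj_by (inv h) (conj_by h a) = a" "conj_by h (conj_by (inv h) a) = a" if "a \<in> A" for a
    using that assms by (simp_all add: subsetD)
  then show "conj_by (inv h) ` conj_by h ` A = A" "conj_by h ` conj_by (inv h) ` A = A"
    by (simp_all add: image_image)
qed

lemma conj_image_stable:
  assumes "h \<in> H" "S \<in> stable" shows "conj_by h ` S = S"
proof
  have sub: "conj_by k ` S \<subseteq> S" if "k \<in> H" for k using assms(2) that unfolding stable_def by auto
  show "conj_by h ` S \<subseteq> S" using sub assms by auto
  have "conj_by h ` conj_by (inv h) ` S \<subseteq> conj_by h ` S"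
    using sub[of "inv h"] assms(1) by (intro image_mono) auto
  then show "S \<subseteq> conj_by h ` S" using conj_image_inv(2)[OF assms(1)] assms(2) by (auto simp: stable_def)
qed

text \<open>Conjugation by \<open>h\<close> is an automorphism of the rack \<open>X\<close>, so it
  permutes the maximal subracks.\<close>

lemma maximal_subrack_conj:
  assumes h: "h \<in> H" and N: "N \<in> maximal_subracks X"
  shows "conj_by h ` N \<in> maximal_subracks X"
proof -
  have sub: "N \<in> subracks X" "N \<noteq> X" "N \<subseteq> X" using N unfolding maximal_subracks_def subracks_def by auto
  have ne: "conj_by k ` A \<noteq> X" if "k \<in> H" "A \<subseteq> X" "A \<noteq> X" for k A
    using conj_image_inv(1)[OF that(1,2)] conj_image_stable[OF H_inv[OF that(1)] X_stable] that(3) by metis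
  have "T = conj_by h ` N" if T: "T \<in> subracks X" "T \<noteq> X" "conj_by h ` N \<subseteq> T" for T
  proof -
    have TX: "T \<subseteq> X" using T unfolding subracks_def by auto
    have "N \<subseteq> conj_by (inv h) ` T" using conj_image_inv(1)[OF h sub(3)] T(3) by blast
    moreover have "conj_by (inv h) ` T \<in> subracks X - {X}"
      using subrack_conj[OF H_inv[OF h] T(1)] ne[OF H_inv[OF h] TX T(2)] by auto
    ultimately have "conj_by (inv h) ` T = N" using N unfolding maximal_subracks_def by auto
    then show ?thesis using conj_image_inv(2)[OF h TX] by simp
  qed
  then show ?thesis
    unfolding maximal_subracks_def using subrack_conj[OF h sub(1)] ne[OF h sub(3,2)] by auto
qed

text \<open>The conjugates of a maximal subrack above the complement of an orbit intersect in that
  complement.\<close>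

lemma stable_in_inf_subracks:
  assumes S: "S \<in> stable" "S \<noteq> {}" "S \<noteq> X"
  shows "S \<in> inf_subracks X"
proof -
  let ?M = "{N \<in> maximal_subracks X. S \<subseteq> N}"
  have SX: "S \<subseteq> X" and Ssub: "S \<in> subracks X" using S stable_subrack by (auto simp: stable_def)
  have "?M \<noteq> {}" using ex_maximal_subrack[OF Ssub S(3)] by auto
  moreover have "x \<in> S" if "x \<in> \<Inter>?M" for x
  proof (rule ccontr)
    assume "x \<notin> S"
    obtain N' where N': "N' \<in> ?M" using \<open>?M \<noteq> {}\<close> by blast
    then have "x \<in> N'" using that by blast
    moreover have "N' \<subseteq> X" using N' unfolding maximal_subracks_def subracks_def by auto
    ultimately have x: "x \<in> X" by blast
    have compl: "X - orbit x \<in> stable"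
    proof -
      have "conj_by h s \<notin> orbit x" if "h \<in> H" "s \<in> X" "s \<notin> orbit x" for h s
        using orbit_conj[OF that(1,2)] orbit_eq[OF x, of "conj_by h s"] orbit_self[OF that(2)] that(3)
        by auto
      then show ?thesis unfolding stable_def using conj_H_X by auto
    qed
    have "S \<subseteq> X - orbit x"
    proof -
      have "s \<notin> orbit x" if "s \<in> S" for s
        using orbit_eq[OF x, of s] orbit_self[OF x] stable_orbit[OF S(1) that] \<open>x \<notin> S\<close> by auto
      then show ?thesis using SX by auto
    qed
    have "X - orbit x \<noteq> X" using orbit_self[OF x] x by auto
    then obtain N where N: "N \<in> maximal_subracks X" "X - orbit x \<subseteq> N"
      using ex_maximal_subrack[OF stable_subrack[OF compl]] by blast
    have NX: "N \<subseteq> X" "N \<noteq> X" using N(1) unfolding maximal_subracks_def subracks_def by auto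
    \<comment> \<open>\<open>S\<close> is stable and so lies below every conjugate of
      \<open>N\<close>. Therefore \<open>x\<close> lies in all these conjugates, which means that
      \<open>N\<close> contains the whole orbit besides its complement.\<close>
    have "conj_by h x \<in> N" if h: "h \<in> H" for h
    proof -
      have "conj_by (inv h) ` N \<in> maximal_subracks X"
        by (rule maximal_subrack_conj[OF H_inv[OF h] N(1)])
      moreover have "S \<subseteq> conj_by (inv h) ` N"
        using conj_image_stable[OF H_inv[OF h] S(1)] \<open>S \<subseteq> X - orbit x\<close> N(2) by blast
      ultimately have "x \<in> conj_by (inv h) ` N" using \<open>x \<in> \<Inter>?M\<close> by blast
      then have "conj_by h x \<in> conj_by h ` conj_by (inv h) ` N" by blast
      then show ?thesis using conj_image_inv(2)[OF h NX(1)] by simp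
    qed
    then have "orbit x \<subseteq> N" unfolding orbit_def by auto
    then show False using N(2) NX by auto
  qed
  ultimately have "S = \<Inter>?M" by blast
  moreover have "S \<in> proper_subracks X" using Ssub S(2,3) unfolding proper_subracks_def by blast
  ultimately show ?thesis
    unfolding inf_subracks_def mem_Collect_eq using \<open>?M \<noteq> {}\<close>
    by (intro conjI exI[of _ ?M]) blast+
qed

subsubsection \<open>Inner automorphisms\<close>

lemma conj_in_Bij:
  assumes "a \<in> X" shows "(\<lambda>b\<in>X. conj_by a b) \<in> Bij X"
proof -
  have "bij_betw (\<lambda>b\<in>X. conj_by a b) X X"
    using assms conj_X inv_X by (intro bij_betw_byWitness[where f' = "conj_by (inv a)"]) auto
  then show ?thesis unfolding Bij_def by auto
qed

text \<open>Membership in \<open>Bij X\<close> is carried through the induction because inverses and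
  products in \<open>BijGroup X\<close> are described only there.\<close>

lemma Inn_conj:
  assumes "\<phi> \<in> Inn X" shows "\<phi> \<in> Bij X \<and> (\<exists>h\<in>H. \<forall>b\<in>X. \<phi> b = conj_by h b)"
  using assms unfolding Inn_def conj_by_def[symmetric]
proof (induction rule: generate.induct)
  case one
  have one: "\<one>\<^bsub>BijGroup X\<^esub> = (\<lambda>x\<in>X. x)" by (simp add: BijGroup_def)
  show ?case unfolding one by (intro conjI id_Bij bexI[OF _ H_one]) auto
next
  case (incl \<phi>)
  then show ?case using conj_in_Bij by (auto intro: generate.incl)
next
  case (inv \<phi>)
  then obtain a where a: "a \<in> X" "\<phi> = (\<lambda>b\<in>X. conj_by a b)" by auto
  then have \<phi>: "\<phi> \<in> Bij X" using conj_in_Bij by auto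
  then have inj: "inj_on \<phi> X" unfolding Bij_def bij_betw_def by auto
  have "inv_into X \<phi> b = conj_by (inv a) b" if "b \<in> X" for b
    using a that conj_X inv_X by (intro inv_into_f_eq[OF inj]) auto
  moreover have "inv a \<in> H" using inv_X[OF a(1)] by (rule generate.incl)
  ultimately show ?case
    unfolding inv_BijGroup[OF \<phi>]
    by (intro conjI restrict_inv_into_Bij[OF \<phi>] bexI[of _ "inv a"]) auto
next
  case (eng \<phi> \<psi>)
  then obtain h k where hk: "h \<in> H" "k \<in> H" "\<forall>b\<in>X. \<phi> b = conj_by h b" "\<forall>b\<in>X. \<psi> b = conj_by k b"
    and Bij: "\<phi> \<in> Bij X" "\<psi> \<in> Bij X" by blast
  have "\<phi> \<otimes>\<^bsub>BijGroup X\<^esub> \<psi> = compose X \<phi> \<psi>" using Bij by (simp add: BijGroup_def)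
  moreover have "compose X \<phi> \<psi> b = conj_by (h \<otimes> k) b" if "b \<in> X" for b
    using hk that conj_H_X by (simp add: compose_def conj_by_mult)
  moreover have "h \<otimes> k \<in> H" using hk by (intro generate.eng)
  ultimately show ?case using compose_Bij[OF Bij] by auto
qed

text \<open>Every proper nonempty union of classes is an intersection of maximal subracks, and
  invariance under \<open>Inn X\<close> and under \<open>H\<close> agree because both reduce to
  conjugation by elements of \<open>X\<close>.\<close>

lemma spherical_iff: "S \<in> spherical_subracks X \<longleftrightarrow> S \<in> stable \<and> S \<noteq> {} \<and> S \<noteq> X"
proof
  assume S: "S \<in> spherical_subracks X"
  then have *: "S \<in> subracks X" "S \<noteq> {}" "S \<noteq> X"
    unfolding spherical_subracks_def inf_subracks_def proper_subracks_def by auto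
  then have "S \<subseteq> X" by (simp add: subracks_def)
  moreover have "conj_by a s \<in> S" if "a \<in> X" "s \<in> S" for a s
  proof -
    have "(\<lambda>b\<in>X. conj_by a b) \<in> Inn X"
      unfolding Inn_def conj_by_def[symmetric] using that by (intro generate.incl) blast
    then have "(\<lambda>b\<in>X. conj_by a b) s \<in> S"
      using S that(2) unfolding spherical_subracks_def by blast
    then show ?thesis using that \<open>S \<subseteq> X\<close> by auto
  qed
  ultimately show "S \<in> stable \<and> S \<noteq> {} \<and> S \<noteq> X"
    using * stable_under_H[of S] unfolding stable_def by auto
next
  assume S: "S \<in> stable \<and> S \<noteq> {} \<and> S \<noteq> X"
  have "\<phi> s \<in> S" if \<phi>: "\<phi> \<in> Inn X" and s: "s \<in> S" for \<phi> s
  proof -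
    obtain h where "h \<in> H" "\<forall>b\<in>X. \<phi> b = conj_by h b" using Inn_conj[OF \<phi>] by blast
    then show ?thesis using S s unfolding stable_def by auto
  qed
  then show "S \<in> spherical_subracks X"
    unfolding spherical_subracks_def using S stable_in_inf_subracks by auto
qed

section \<open>Intersections of maximal subracks and the retraction\<close>

definition inf_closure :: "'a set \<Rightarrow> 'a set" where
  "inf_closure A = \<Inter>{N \<in> maximal_subracks X. A \<subseteq> N}"

lemma inf_closure_ge: "A \<subseteq> inf_closure A"
  unfolding inf_closure_def by auto

lemma inf_closure_mono: "A \<subseteq> B \<Longrightarrow> inf_closure A \<subseteq> inf_closure B"
  unfolding inf_closure_def by auto

lemma inf_closure_in:
  assumes "A \<in> proper_subracks X" shows "inf_closure A \<in> inf_subracks X"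
proof -
  let ?M = "{N \<in> maximal_subracks X. A \<subseteq> N}"
  have ne: "?M \<noteq> {}" and A: "A \<noteq> {}"
    using ex_maximal_subrack[of A] assms unfolding proper_subracks_def by auto
  then obtain N where N: "N \<in> ?M" by blast
  have M: "?M \<subseteq> subracks X" unfolding maximal_subracks_def by auto
  have "inf_closure A \<subseteq> N" "N \<subseteq> X" "N \<noteq> X"
    using N unfolding inf_closure_def maximal_subracks_def subracks_def by auto
  moreover have "inf_closure A \<in> subracks X"
    unfolding inf_closure_def by (rule subracks_Inter[OF M ne])
  ultimately have "inf_closure A \<in> proper_subracks X"
    using A inf_closure_ge[of A] unfolding proper_subracks_def by auto
  then show ?thesis
    unfolding inf_subracks_def mem_Collect_eq using ne
    by (intro conjI exI[of _ ?M]) (auto simp: inf_closure_def)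
qed

lemma inf_closure_id: "P \<in> inf_subracks X \<Longrightarrow> inf_closure P = P"
  unfolding inf_subracks_def inf_closure_def by blast

end

text \<open>With two classes, each single class is a proper subset of \<open>X\<close> and hence
  spherical.\<close>

locale conjugation_rack_two_classes = conjugation_rack +
  assumes two_classes: "card (conj_classes_in H X) \<ge> 2"
begin

lemma orbit_spherical:
  assumes "x \<in> X" shows "orbit x \<in> spherical_subracks X"
proof -
  have "orbit x \<noteq> X"
  proof
    assume "orbit x = X"
    then have "orbit y = X" if "y \<in> X" for y using orbit_eq[OF assms, of y] that by simp
    then have "orbit ` X \<subseteq> {X}" by blast
    then have "card (orbit ` X) \<le> card {X}" by (intro card_mono) auto
    then show False using two_classes conj_classes_eq by simp
  qed
  moreover have "conj_by h s \<in> orbit x" if "h \<in> H" "s \<in> orbit x" for h s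
  proof -
    have "s \<in> X" using orbit_subset[OF assms] that(2) by auto
    then show ?thesis
      using orbit_eq[OF assms that(2)] orbit_conj[OF that(1)] orbit_self[OF conj_H_X[OF that(1)]]
      by metis
  qed
  ultimately show ?thesis
    unfolding spherical_iff stable_def using orbit_subset[OF assms] orbit_self[OF assms] by auto
qed

text \<open>Single classes are spherical and every spherical subrack contains one, so meeting all
  spherical subracks means meeting all classes.\<close>

lemma parabolic_iff: "P \<in> parabolic_subracks X \<longleftrightarrow> P \<in> inf_subracks X \<and> saturation P = X"
proof -
  have "saturation P = X" if "\<And>S. S \<in> spherical_subracks X \<Longrightarrow> P \<inter> S \<noteq> {}"
    using that[OF orbit_spherical] unfolding saturation_def by blast
  moreover have "P \<inter> S \<noteq> {}" if "saturation P = X" "S \<in> spherical_subracks X" for S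
    using saturation_Int_stable[of S P] that unfolding spherical_iff saturation_def by auto
  ultimately show ?thesis unfolding parabolic_subracks_def by auto
qed

definition retraction :: "'a set \<Rightarrow> 'a set" where
  "retraction A = (if saturation A = X then inf_closure A else saturation A)"

sublocale two_tier "proper_subracks X" "spherical_subracks X" "parabolic_subracks X" X retraction
proof
  have R: "A \<subseteq> X" "A \<noteq> X" "A \<noteq> {}" "A \<in> subracks X" if "A \<in> proper_subracks X" for A
    using that unfolding proper_subracks_def subracks_def by auto
  show "finite (proper_subracks X)" unfolding proper_subracks_def using finite_subracks by auto
  show "spherical_subracks X \<subseteq> proper_subracks X" "parabolic_subracks X \<subseteq> proper_subracks X"
    unfolding spherical_subracks_def parabolic_subracks_def inf_subracks_def by auto
  show disj: "spherical_subracks X \<inter> parabolic_subracks X = {}"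
    using saturation_id unfolding spherical_iff parabolic_iff disjoint_iff by metis
  show "A \<subseteq> X" if "A \<in> proper_subracks X" for A using R[OF that] by auto
  show "X \<notin> proper_subracks X" "{} \<notin> proper_subracks X" unfolding proper_subracks_def by auto
  have par: "inf_closure A \<in> parabolic_subracks X" if "A \<in> proper_subracks X" "saturation A = X" for A
    unfolding parabolic_iff
    using inf_closure_in[OF that(1)] saturation_mono[OF inf_closure_ge[of A]] that(2)
    by (auto simp: saturation_def)
  have sph: "saturation A \<in> spherical_subracks X" if "A \<in> proper_subracks X" "saturation A \<noteq> X" for A
    unfolding spherical_iff
    using saturation_stable that(2) saturation_ge[OF R(1)[OF that(1)]] R(3)[OF that(1)] by auto
  show "retraction A \<in> spherical_subracks X \<union> parabolic_subracks X" if "A \<in> proper_subracks X" for A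
    using par[OF that] sph[OF that] unfolding retraction_def by auto
  have S_iff: "retraction A \<in> spherical_subracks X \<longleftrightarrow> saturation A \<noteq> X" if "A \<in> proper_subracks X" for A
    using par[OF that] sph[OF that] disj unfolding retraction_def by auto
  show "A \<subseteq> retraction A" if "A \<in> proper_subracks X" for A
    using inf_closure_ge saturation_ge R(1)[OF that] unfolding retraction_def by auto
  show "retraction A \<in> spherical_subracks X"
    if "A \<in> proper_subracks X" "B \<in> proper_subracks X" "A \<subseteq> B" "retraction B \<in> spherical_subracks X" for A B
    using that S_iff saturation_mono[OF that(3)] by (auto simp: saturation_def)
  show "retraction A \<subseteq> retraction B"
    if "A \<in> proper_subracks X" "B \<in> proper_subracks X" "A \<subseteq> B"
      "retraction A \<in> spherical_subracks X \<longleftrightarrow> retraction B \<in> spherical_subracks X" for A B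
    using that S_iff saturation_mono[OF that(3)] inf_closure_mono[OF that(3)]
    unfolding retraction_def by auto
  show "retraction A = A" if "A \<in> spherical_subracks X \<union> parabolic_subracks X" for A
    using that
  proof
    assume "A \<in> spherical_subracks X"
    then show ?thesis unfolding spherical_iff retraction_def using saturation_id[of A] by simp
  next
    assume "A \<in> parabolic_subracks X"
    then show ?thesis unfolding parabolic_iff retraction_def using inf_closure_id[of A] by simp
  qed
  fix J P assume "J \<in> spherical_subracks X" "P \<in> parabolic_subracks X"
  then have J: "J \<in> stable" "J \<noteq> {}" "J \<noteq> X" and P: "P \<in> inf_subracks X" "saturation P = X"
    unfolding spherical_iff parabolic_iff by auto
  \<comment> \<open>Besides \<open>f_meet\<close> this gives \<open>meet_in\<close>: the saturation
    is neither \<open>{}\<close> nor \<open>X\<close>, so neither is the meet.\<close>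
  have sat: "saturation (J \<inter> P) = J" by (rule saturation_Int_stable[OF J(1) P(2)])
  then show "retraction (J \<inter> P) = J" unfolding retraction_def using J by auto
  have "J \<inter> P \<in> subracks X"
    using stable_subrack[OF J(1)] P(1) subracks_Int
    unfolding inf_subracks_def proper_subracks_def by auto
  moreover have "J \<inter> P \<noteq> X" using sat J saturation_X by auto
  moreover have "J \<inter> P \<noteq> {}" using sat J by (auto simp: saturation_def)
  ultimately show "J \<inter> P \<in> proper_subracks X" unfolding proper_subracks_def by auto
qed

text \<open>After numbering the classes, sending a union of classes to the indices of the classes it
  contains is an order isomorphism onto the power set. The spherical subracks correspond to the
  proper nonempty subsets.\<close>

lemma spherical_homeomorphic_nsphere:
  assumes card: "card (conj_classes_in H X) = Suc (Suc m)"
  shows "top_of_set (chain_points (spherical_subracks X) (\<subseteq>)) homeomorphic_space nsphere m"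
proof -
  have "finite (orbit ` X)" using finite_X by auto
  then obtain e where "bij_betw e {0..<Suc (Suc m)} (orbit ` X)"
    using ex_bij_betw_nat_finite[of "orbit ` X"] card conj_classes_eq by auto
  then have e: "bij_betw e {..Suc m} (orbit ` X)"
    by (simp add: atLeast0LessThan lessThan_Suc_atMost)
  define s where "s A = {i \<in> {..Suc m}. e i \<subseteq> A}" for A
  have e_in: "e i \<in> orbit ` X" if "i \<in> {..Suc m}" for i
    using e that unfolding bij_betw_def by blast
  have e_ex: "\<exists>i\<in>{..Suc m}. e i = orbit x" if "x \<in> X" for x
    using e that unfolding bij_betw_def by (metis imageE imageI)
  have mono: "A \<subseteq> B \<longleftrightarrow> s A \<subseteq> s B" if A: "A \<in> stable" and B: "B \<in> stable" for A B
  proof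
    assume "s A \<subseteq> s B"
    show "A \<subseteq> B"
    proof
      fix x assume x: "x \<in> A"
      then have "x \<in> X" using A by (auto simp: stable_def)
      then obtain i where i: "i \<in> {..Suc m}" "e i = orbit x" using e_ex by blast
      then have "i \<in> s A" using stable_orbit[OF A x] by (auto simp: s_def)
      then have "orbit x \<subseteq> B" using \<open>s A \<subseteq> s B\<close> i by (auto simp: s_def)
      then show "x \<in> B" using orbit_self \<open>x \<in> X\<close> by auto
    qed
  qed (auto simp: s_def)
  have s_Union: "(\<Union>i\<in>K. e i) \<in> stable \<and> s (\<Union>i\<in>K. e i) = K" if K: "K \<subseteq> {..Suc m}" for K
  proof
    have "conj_by h y \<in> e i" if "i \<in> K" "h \<in> H" "y \<in> e i" for h y i
    proof -
      obtain x where x: "x \<in> X" "e i = orbit x" using e_in \<open>i \<in> K\<close> K by blast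
      then show ?thesis
        using that orbit_spherical[OF x(1)] unfolding spherical_iff stable_def by auto
    qed
    moreover have "e i \<subseteq> X" if "i \<in> K" for i using e_in orbit_subset that K by blast
    ultimately show "(\<Union>i\<in>K. e i) \<in> stable" unfolding stable_def by blast
    have "i \<in> K" if i: "i \<in> {..Suc m}" "e i \<subseteq> (\<Union>i\<in>K. e i)" for i
    proof -
      obtain x where x: "x \<in> X" "e i = orbit x" using e_in[OF i(1)] by blast
      then have "x \<in> e i" using orbit_self by simp
      then obtain j where j: "j \<in> K" "x \<in> e j" using i(2) by blast
      obtain y where y: "y \<in> X" "e j = orbit y" using e_in j(1) K by blast
      have "e i = e j" using orbit_eq[OF y(1), of x] x y j(2) by auto
      then have "i = j" using e i(1) j(1) K unfolding bij_betw_def by (auto dest: inj_onD)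
      then show ?thesis using j(1) by simp
    qed
    then show "s (\<Union>i\<in>K. e i) = K" using K by (auto simp: s_def)
  qed
  have s_empty: "s {} = {}"
    using s_Union[of "{}"] by simp
  have s_X: "s X = {..Suc m}"
    using e_in orbit_subset unfolding s_def by blast
  have empty_stable: "{} \<in> stable" by (simp add: stable_def)
  have s_eq: "A = B \<longleftrightarrow> s A = s B" if "A \<in> stable" "B \<in> stable" for A B
    using mono[OF that] mono[OF that(2,1)] by auto
  have "bij_betw s (spherical_subracks X) (Pow {..Suc m} - {{}, {..Suc m}})"
    unfolding bij_betw_def
  proof
    show "inj_on s (spherical_subracks X)"
      by (rule inj_onI) (use s_eq in \<open>auto simp: spherical_iff\<close>)
    show "s ` spherical_subracks X = Pow {..Suc m} - {{}, {..Suc m}}"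
    proof (intro equalityI subsetI)
      fix K assume "K \<in> s ` spherical_subracks X"
      then obtain S where K: "K = s S" and "S \<in> spherical_subracks X" by blast
      then have "S \<in> stable" "S \<noteq> {}" "S \<noteq> X" by (simp_all add: spherical_iff)
      then have "s S \<noteq> {}" "s S \<noteq> {..Suc m}"
        using s_eq[of S "{}"] s_eq[of S X] X_stable empty_stable s_X s_empty by simp_all
      moreover have "s S \<subseteq> {..Suc m}" by (auto simp: s_def)
      ultimately show "K \<in> Pow {..Suc m} - {{}, {..Suc m}}" using K by simp
    next
      fix K assume K: "K \<in> Pow {..Suc m} - {{}, {..Suc m}}"
      then obtain V where V: "V \<in> stable" "s V = K" using s_Union by blast
      then have "V \<in> spherical_subracks X"
        using K s_X s_empty unfolding spherical_iff by auto
      then show "K \<in> s ` spherical_subracks X" using V(2) by blast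
    qed
  qed
  then show ?thesis
    by (rule Boolean_lattice_homeomorphic_nsphere) (use mono spherical_iff in auto)
qed

theorem order_complex_homotopy_equivalent_join:
  "order_complex (proper_subracks X) (\<subseteq>) homotopy_equivalent_space
     join_space (sphere_space (int (card (conj_classes_in H X)) - 2))
       (order_complex (parabolic_subracks X) (\<subseteq>))"
proof -
  obtain m where "card (conj_classes_in H X) = 2 + m"
    using le_Suc_ex[OF two_classes] by blast
  then have m: "card (conj_classes_in H X) = Suc (Suc m)" by simp
  have sphere: "sphere_space (int (card (conj_classes_in H X)) - 2) = nsphere m"
    by (simp add: sphere_space_def m)
  have "nsphere m homeomorphic_space top_of_set (chain_points (spherical_subracks X) (\<subseteq>))"
    using spherical_homeomorphic_nsphere[OF m] homeomorphic_space_sym by blast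
  then have "join_space (nsphere m) (top_of_set (chain_points (parabolic_subracks X) (\<subseteq>)))
      homeomorphic_space top_of_set model"
    by (rule join_space_chain_points[OF finite_SS finite_PP disj])
  then have "top_of_set model homotopy_equivalent_space
      join_space (nsphere m) (top_of_set (chain_points (parabolic_subracks X) (\<subseteq>)))"
    using homeomorphic_imp_homotopy_equivalent_space homeomorphic_space_sym by blast
  then show ?thesis
    unfolding order_complex_eq sphere
    by (rule homotopy_eqv_trans[OF homotopy_equivalent_model])
qed

end

section \<open>Elements of prime power order in a finite group\<close>

context group
begin

lemma p_elements_conjugation_rack:
  assumes "finite (carrier G)"
  shows "conjugation_rack G (p_elements p)"
proof
  show "p_elements p \<subseteq> carrier G" unfolding p_elements_def by auto
  then show "finite (p_elements p)" using assms finite_subset by auto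
qed (auto simp: p_elements_def ord_conj_by)

text \<open>The identity has order \<open>p ^ 0\<close> and forms a class by itself; an element of
  order \<open>p\<close>, supplied by Cauchy's theorem, lies in another.\<close>

lemma p_elements_two_classes:
  assumes "finite (carrier G)" "prime p" "p dvd order G"
  shows "conjugation_rack_two_classes G (p_elements p)"
proof -
  interpret conjugation_rack G "p_elements p" by (rule p_elements_conjugation_rack[OF assms(1)])
  obtain x where x: "x \<in> carrier G" "ord x = p" using ex_ord_eq_prime[OF assms] by blast
  have xp: "x \<in> p_elements p" and onep: "\<one> \<in> p_elements p"
    unfolding p_elements_def using x by (auto intro: exI[of _ 1] exI[of _ 0])
  have "x \<noteq> \<one>" using x ord_id prime_gt_1_nat[OF assms(2)] by auto
  have "orbit \<one> \<subseteq> {\<one>}" unfolding orbit_def conj_by_def by auto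
  then have "orbit x \<noteq> orbit \<one>" using orbit_self[OF xp] \<open>x \<noteq> \<one>\<close> by auto
  then have "card {orbit x, orbit \<one>} = 2" by simp
  moreover have "card {orbit x, orbit \<one>} \<le> card (conj_classes_in H (p_elements p))"
    unfolding conj_classes_eq using finite_X xp onep by (intro card_mono) auto
  ultimately show ?thesis by unfold_locales simp
qed

end

theorem mainTheorem10:
  fixes G (structure) and p :: nat
  assumes "group G" and "finite (carrier G)" and "prime p" and "p dvd order G"
  defines "Gp \<equiv> group.p_elements G p"
  defines "c \<equiv> card (group.conj_classes_in G (generate G Gp) Gp)"
  shows "(order_complex (group.proper_subracks G Gp) (\<subseteq>))
           homotopy_equivalent_space
           (join_space (sphere_space (int c - 2))
                       (order_complex (group.parabolic_subracks G Gp) (\<subseteq>)))"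
proof -
  interpret conjugation_rack_two_classes G Gp
    unfolding Gp_def by (rule group.p_elements_two_classes[OF assms(1-4)])
  show ?thesis unfolding c_def by (rule order_complex_homotopy_equivalent_join)
qed

end
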